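(* There exists a data structure in the word RAM model with word size $\Theta(\log n)$ that, for any $n$-vertex interval graph given in universal interval representation, uses $\log_2(n!)+O(\sqrt{n}\log n)$ bits of space and answers adjacency queries $\mathrm{adj}(u,v)$ in $O(1)$ time.
   Context: An interval graph has an interval $I_v$ of the real line for each vertex $v$, with $u,v$ adjacent iff $I_u\cap I_v\neq\emptyset$. A universal interval representation of an $n$-vertex interval graph is an interval representation in which every $i\in[n]$ is the left endpoint of exactly one interval; vertex $i$ is identified with the interval $I_i=[i,e_i]$ with integer $e_i\in[i,n]$. Queries refer to vertices by these labels. $\mathrm{adj}(u,v)$ returns whether $u$ and $v$ are adjacent. The data structure need not retain access to the input after preprocessing. *)

theory Defs
  imports "HOL-Analysis.Analysis" "HOL-Library.Landau_Symbols"
begin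

section \<open>Interval graphs\<close>

text \<open>
  A simple graph is given by a vertex set \<open>V\<close> and an adjacency predicate \<open>E\<close>. Graphs are
  loopless, so a vertex is never adjacent to itself although its interval meets itself.
\<close>

definition interval_representation ::
  "'a set \<Rightarrow> ('a \<Rightarrow> 'a \<Rightarrow> bool) \<Rightarrow> ('a \<Rightarrow> real set) \<Rightarrow> bool" where
  "interval_representation V E I \<longleftrightarrow>
     (\<forall>v\<in>V. is_interval (I v) \<and> I v \<noteq> {}) \<and>
     (\<forall>u\<in>V. \<forall>v\<in>V. E u v \<longleftrightarrow> u \<noteq> v \<and> I u \<inter> I v \<noteq> {})"

text \<open>
  Vertices are already identified with the left endpoints of their intervals: vertex \<open>i\<close> carries
  the interval from \<open>i\<close> to \<open>e i\<close>, so each \<open>i\<close> in \<open>{1..n}\<close> is the left endpoint of exactly one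
  interval.
\<close>

definition universal_interval_representation ::
  "nat \<Rightarrow> (nat \<Rightarrow> nat \<Rightarrow> bool) \<Rightarrow> (nat \<Rightarrow> nat) \<Rightarrow> bool" where
  "universal_interval_representation n E e \<longleftrightarrow>
     (\<forall>i\<in>{1..n}. e i \<in> {i..n}) \<and>
     interval_representation {1..n} E (\<lambda>i. {real i..real (e i)})"


section \<open>The word RAM\<close>

text \<open>
  The word size \<open>w\<close> has to vary with the input, so words are natural numbers below \<open>2 ^ w\<close> and all
  arithmetic is modulo \<open>2 ^ w\<close>. Registers are named by constants of the (finite) program; hence a
  program has only constantly many of them, and only the memory can be addressed indirectly.
\<close>

datatype binop = ADD | SUB | MUL | DIV | MOD | AND | OR | XOR | SHL | SHR

datatype instr =
    LITERAL nat nat         \<comment> \<open>target register, literal\<close>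
  | BINOP binop nat nat nat \<comment> \<open>target register, operand registers\<close>
  | LOAD nat nat            \<comment> \<open>target register, address register\<close>
  | STORE nat nat           \<comment> \<open>address register, source register\<close>
  | JUMP nat                \<comment> \<open>program position\<close>
  | JUMP_EQ nat nat nat     \<comment> \<open>compared registers, program position\<close>
  | JUMP_LESS nat nat nat   \<comment> \<open>compared registers, program position\<close>
  | HALT

fun eval_binop :: "nat \<Rightarrow> binop \<Rightarrow> nat \<Rightarrow> nat \<Rightarrow> nat" where
  "eval_binop w ADD x y = (x + y) mod 2 ^ w"
| "eval_binop w SUB x y = (x + 2 ^ w - y) mod 2 ^ w"
| "eval_binop w MUL x y = (x * y) mod 2 ^ w"
| "eval_binop w DIV x y = x div y"
| "eval_binop w MOD x y = x mod y"
| "eval_binop w AND x y = semiring_bit_operations_class.and x y"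
| "eval_binop w OR  x y = semiring_bit_operations_class.or x y"
| "eval_binop w XOR x y = semiring_bit_operations_class.xor x y"
| "eval_binop w SHL x y = push_bit y x mod 2 ^ w"
| "eval_binop w SHR x y = drop_bit y x"

record config =
  pc   :: nat
  regs :: "nat \<Rightarrow> nat"
  mem  :: "nat list"

definition set_reg :: "nat \<Rightarrow> nat \<Rightarrow> config \<Rightarrow> config" where
  "set_reg r x c = c\<lparr>pc := Suc (pc c), regs := (regs c)(r := x)\<rparr>"

text \<open>
  The machine is stuck (\<open>None\<close>) after halting, when control leaves the program, and when an address
  outside the allocated memory is accessed. Thus a program cannot use any memory beyond the cells
  that are charged as space.
\<close>

fun exec_instr :: "nat \<Rightarrow> instr \<Rightarrow> config \<Rightarrow> config option" where
  "exec_instr w (LITERAL r k) c = Some (set_reg r (k mod 2 ^ w) c)"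
| "exec_instr w (BINOP f r a b) c = Some (set_reg r (eval_binop w f (regs c a) (regs c b)) c)"
| "exec_instr w (LOAD r a) c =
     (if regs c a < length (mem c) then Some (set_reg r (mem c ! regs c a) c) else None)"
| "exec_instr w (STORE a s) c =
     (if regs c a < length (mem c)
      then Some (c\<lparr>pc := Suc (pc c), mem := (mem c)[regs c a := regs c s]\<rparr>) else None)"
| "exec_instr w (JUMP l) c = Some (c\<lparr>pc := l\<rparr>)"
| "exec_instr w (JUMP_EQ a b l) c =
     Some (c\<lparr>pc := (if regs c a = regs c b then l else Suc (pc c))\<rparr>)"
| "exec_instr w (JUMP_LESS a b l) c =
     Some (c\<lparr>pc := (if regs c a < regs c b then l else Suc (pc c))\<rparr>)"
| "exec_instr w HALT c = None"

definition step :: "nat \<Rightarrow> instr list \<Rightarrow> config \<Rightarrow> config \<Rightarrow> bool" where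
  "step w P c c' \<longleftrightarrow> pc c < length P \<and> exec_instr w (P ! pc c) c = Some c'"

definition halted :: "instr list \<Rightarrow> config \<Rightarrow> bool" where
  "halted P c \<longleftrightarrow> pc c < length P \<and> P ! pc c = HALT"

definition query_config :: "nat list \<Rightarrow> nat \<Rightarrow> nat \<Rightarrow> config" where
  "query_config m u v = \<lparr>pc = 0, regs = (\<lambda>_. 0)(0 := u, 1 := v), mem = m\<rparr>"

text \<open>
  Besides the memory \<open>m\<close>, the program receives only the two query arguments, in registers 0 and 1.
  The answer is left in register 0. Queries may use the memory as scratch space but must restore
  it, so that any sequence of queries is answered correctly.
\<close>

definition answers_query ::
  "nat \<Rightarrow> instr list \<Rightarrow> nat list \<Rightarrow> nat \<Rightarrow> nat \<Rightarrow> nat \<Rightarrow> bool \<Rightarrow> bool" where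
  "answers_query w P m T u v b \<longleftrightarrow>
     (\<exists>t\<le>T. \<exists>c. (step w P ^^ t) (query_config m u v) c \<and> halted P c \<and>
        mem c = m \<and> regs c 0 = (if b then 1 else 0))"

text \<open>
  A (static) data structure consists of a query program \<open>P\<close>, the same for all \<open>n\<close>, and of the
  preprocessing map \<open>enc\<close> that produces the initial memory from the input. Its space is the number
  of memory cells times the word size.
\<close>

definition adjacency_data_structure ::
  "(nat \<Rightarrow> nat) \<Rightarrow> instr list \<Rightarrow> (nat \<Rightarrow> (nat \<Rightarrow> nat) \<Rightarrow> nat list) \<Rightarrow> (nat \<Rightarrow> real) \<Rightarrow> nat \<Rightarrow> bool" where
  "adjacency_data_structure w P enc S T \<longleftrightarrow>
     (\<forall>n E e. universal_interval_representation n E e \<longrightarrow>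
        (\<forall>x\<in>set (enc n e). x < 2 ^ w n) \<and>
        real (w n * length (enc n e)) \<le> S n \<and>
        (\<forall>u\<in>{1..n}. \<forall>v\<in>{1..n}. answers_query (w n) P (enc n e) T u v (E u v)))"

end

theory Submission
  imports Defs "HOL-Library.Log_Nat" "HOL-Real_Asymp.Real_Asymp"
begin

text \<open>
  For \<open>u < v\<close>, adjacency means \<open>v \<le> e u\<close>, so it suffices to store the endpoints. The \<open>k\<close>-th item is
  \<open>x k = e i - i\<close> with \<open>i = n - k\<close>, a number of at most \<open>k\<close>, and \<open>n!\<close> counts all such sequences.

  Arrange the items in rows of length \<open>s = 4 * t\<close> with \<open>t\<close> about \<open>sqrt n\<close>, and treat the items of row \<open>b\<close>
  as numbers below \<open>(b + 1) * s\<close>; in total this costs only \<open>O(s * log n)\<close> bits. Two bits of every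
  item are stored separately, which keeps all other fields shorter than a word. The remaining parts \<open>x'\<close>
  of a column are stored by a spill-over chain in the style of Dodis, Patrascu and Thorup: if the spill \<open>y\<close>
  from the previous row is below \<open>Y\<close>, choose the least \<open>M\<close> with \<open>Y * t \<le> 2 ^ M\<close> and put
  \<open>C = 2 ^ M div Y\<close>; store \<open>y * C + x' mod C\<close> in \<open>M\<close> bits and pass \<open>x' div C\<close> to the next row.
  As \<open>Y\<close>, \<open>M\<close> and \<open>C\<close> depend on the row but not on the column, one table of \<open>O(sqrt n)\<close> words
  serves all columns, and two consecutive rows determine an item.
\<close>

section \<open>Packed arrays\<close>

text \<open>For positive \<open>M\<close> the fields form one bit string, field \<open>p\<close>
  starting at position \<open>p * M\<close> with its lowest bit first, and the string is cut into
  words of \<open>w\<close> bits. Specifying each bit separately reduces decoding to a comparison of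
  bits.\<close>

definition packed_word :: "nat \<Rightarrow> nat \<Rightarrow> (nat \<Rightarrow> nat) \<Rightarrow> nat \<Rightarrow> nat" where
  "packed_word w M f j =
     horner_sum of_bool 2 (map (\<lambda>i. bit (f ((w * j + i) div M)) ((w * j + i) mod M)) [0..<w])"

lemma bit_packed_word_iff:
  "bit (packed_word w M f j) i \<longleftrightarrow>
     i < w \<and> bit (f ((w * j + i) div M)) ((w * j + i) mod M)"
  by (auto simp: packed_word_def bit_horner_sum_bit_iff)

lemma less_two_power_if_bits:
  fixes a :: nat
  assumes "\<And>i. bit a i \<Longrightarrow> i < k"
  shows "a < 2 ^ k"
proof -
  have "take_bit k a = a"
    by (rule bit_eqI) (auto simp: bit_take_bit_iff dest: assms)
  then show ?thesis
    by (simp add: take_bit_nat_eq_self_iff)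
qed

lemma packed_word_less: "packed_word w M f j < 2 ^ w"
  by (rule less_two_power_if_bits) (simp add: bit_packed_word_iff)

definition packed_length :: "nat \<Rightarrow> nat \<Rightarrow> nat \<Rightarrow> nat" where
  "packed_length w M s = s * M div w + 2"

text \<open>The extra last word lets a field be read from two consecutive words in all cases.\<close>

definition packed_array :: "nat \<Rightarrow> nat \<Rightarrow> nat \<Rightarrow> (nat \<Rightarrow> nat) \<Rightarrow> nat list" where
  "packed_array w M s f = map (packed_word w M f) [0..<packed_length w M s]"

lemma length_packed_array [simp]: "length (packed_array w M s f) = packed_length w M s"
  by (simp add: packed_array_def)

lemma packed_array_nth: "j < packed_length w M s \<Longrightarrow> packed_array w M s f ! j = packed_word w M f j"
  by (simp add: packed_array_def)

lemma bit_less_two_power: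
  fixes a :: nat
  assumes "a < 2 ^ k" "bit a i"
  shows "i < k"
  using assms by (metis bit_take_bit_iff take_bit_nat_eq_self)

text \<open>This mirrors the shifts of the query program. The low word moves down by
  \<open>r\<close>, the high word moves up to follow it, and shifting left and right by
  \<open>w - M\<close> clears everything above the field without a mask. The reductions modulo
  \<open>2 ^ w\<close> are those of \<open>SHL\<close>.\<close>

definition extract_field :: "nat \<Rightarrow> nat \<Rightarrow> nat \<Rightarrow> nat \<Rightarrow> nat \<Rightarrow> nat" where
  "extract_field w M r lo hi =
     drop_bit (w - M) (push_bit (w - M)
       (semiring_bit_operations_class.or (drop_bit r lo) (push_bit (w - r) hi mod 2 ^ w)) mod 2 ^ w)"

text \<open>A field of at most \<open>w\<close> bits starting at offset \<open>r\<close> of word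
  \<open>q\<close> meets only words \<open>q\<close> and \<open>q + 1\<close>. Its bit
  \<open>i\<close> is bit \<open>r + i\<close> of the first if this is below \<open>w\<close>, and
  otherwise bit \<open>i - (w - r)\<close> of the second.\<close>

lemma extract_packed_word:
  assumes "M \<le> w" "f p < 2 ^ M" "0 < M"
  shows "extract_field w M (p * M mod w) (packed_word w M f (p * M div w))
           (packed_word w M f (p * M div w + 1)) = f p"
proof (rule bit_eqI)
  fix i
  define r where "r = p * M mod w"
  define q where "q = p * M div w"
  have "0 < w" using assms by simp
  have r: "r < w" using \<open>0 < w\<close> by (simp add: r_def)
  have pM: "w * q + r = p * M" by (simp add: r_def q_def)
  have field: "(p * M + i) div M = p" "(p * M + i) mod M = i" if "i < M"
    using that by (auto simp: add.commute)
  have low: "w * q + (r + i) = p * M + i" using pM by simp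
  have high: "w * (q + 1) + (i - (w - r)) = p * M + i" if "w - r \<le> i"
  proof -
    have "w * (q + 1) + (i - (w - r)) = w * q + w + (i - (w - r))" by simp
    also have "\<dots> = (w * q + r) + i" using that r by linarith
    finally show ?thesis using pM by simp
  qed
  show "bit (extract_field w M (p * M mod w) (packed_word w M f (p * M div w))
           (packed_word w M f (p * M div w + 1))) i = bit (f p) i"
  proof (cases "i < M")
    case True
    then have "r + i < w \<or> w - r \<le> i" by linarith
    moreover have "bit (packed_word w M f q) (r + i) \<longleftrightarrow> r + i < w \<and> bit (f p) i"
      unfolding bit_packed_word_iff low field[OF True] ..
    moreover have "bit (packed_word w M f (q + 1)) (i - (w - r)) \<longleftrightarrow> bit (f p) i" if "w - r \<le> i"
      unfolding bit_packed_word_iff high[OF that] field[OF True] using True assms(1) r by auto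
    ultimately show ?thesis
      using True assms(1)
      unfolding extract_field_def r_def[symmetric] q_def[symmetric] take_bit_eq_mod[symmetric]
      by (auto simp: bit_drop_bit_eq bit_push_bit_iff bit_take_bit_iff bit_or_iff)
  next
    case False
    then have "\<not> bit (f p) i" using bit_less_two_power[OF assms(2)] by blast
    then show ?thesis
      using False assms(1) unfolding extract_field_def take_bit_eq_mod[symmetric]
      by (auto simp: bit_simps)
  qed
qed

section \<open>Straight-line programs\<close>

text \<open>An evaluator for code that neither jumps nor writes to memory: the registers are the
  only state, so the simplifier can run a block symbolically. Every other instruction yields
  \<open>None\<close>.\<close>

fun straight :: "nat \<Rightarrow> nat list \<Rightarrow> instr list \<Rightarrow> (nat \<Rightarrow> nat) \<Rightarrow> (nat \<Rightarrow> nat) option" where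
  "straight w m [] \<rho> = Some \<rho>"
| "straight w m (LITERAL r k # is) \<rho> = straight w m is (\<rho>(r := k mod 2 ^ w))"
| "straight w m (BINOP f r a b # is) \<rho> = straight w m is (\<rho>(r := eval_binop w f (\<rho> a) (\<rho> b)))"
| "straight w m (LOAD r a # is) \<rho> =
     (if \<rho> a < length m then straight w m is (\<rho>(r := m ! \<rho> a)) else None)"
| "straight w m _ \<rho> = None"

text \<open>The surrounding code \<open>pre\<close> and \<open>post\<close> lets a block be verified
  apart from its position. In the induction each executed instruction moves to the end of
  \<open>pre\<close>.\<close>

lemma straight_steps:
  assumes "straight w m is \<rho> = Some \<rho>'"
  shows "(step w (pre @ is @ post) ^^ length is)
    \<lparr>pc = length pre, regs = \<rho>, mem = m\<rparr> \<lparr>pc = length pre + length is, regs = \<rho>', mem = m\<rparr>"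
  using assms
proof (induction "is" arbitrary: \<rho> pre)
  case Nil
  then show ?case by simp
next
  case (Cons i "is")
  obtain \<rho>1 where 1: "exec_instr w i \<lparr>pc = length pre, regs = \<rho>, mem = m\<rparr> =
        Some \<lparr>pc = length (pre @ [i]), regs = \<rho>1, mem = m\<rparr>"
    and 2: "straight w m is \<rho>1 = Some \<rho>'"
    using Cons.prems by (cases i) (auto simp: set_reg_def split: if_splits)
  have "step w (pre @ (i # is) @ post) \<lparr>pc = length pre, regs = \<rho>, mem = m\<rparr>
      \<lparr>pc = length (pre @ [i]), regs = \<rho>1, mem = m\<rparr>"
    using 1 by (simp add: step_def)
  moreover have "(step w (pre @ (i # is) @ post) ^^ length is)
      \<lparr>pc = length (pre @ [i]), regs = \<rho>1, mem = m\<rparr>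
      \<lparr>pc = length pre + length (i # is), regs = \<rho>', mem = m\<rparr>"
    using Cons.IH[OF 2, of "pre @ [i]"] by simp
  ultimately show ?case
    by (metis length_Cons relpowp_Suc_I2)
qed

section \<open>The memory layout\<close>

text \<open>Strictly more than \<open>sqrt n\<close>: this keeps the number of full rows below
  \<open>t\<close>, makes \<open>t\<close> positive for \<open>n = 0\<close>, and gives
  \<open>t \<ge> 2\<close> as soon as \<open>n > 0\<close>.\<close>

definition quarter :: "nat \<Rightarrow> nat" where
  "quarter n = Suc (nat \<lfloor>sqrt (real n)\<rfloor>)"

definition side :: "nat \<Rightarrow> nat" where
  "side n = 4 * quarter n"

text \<open>Rows \<open>0\<close> to \<open>n div side n\<close> contain all items. The memory
  stores one further row, with index \<open>row_count n\<close>, since the spill of a row is kept in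
  its successor.\<close>

definition row_count :: "nat \<Rightarrow> nat" where
  "row_count n = n div side n + 1"

text \<open>Row 0 receives only the spill 0. The inner expressions are \<open>width t b\<close> and
  \<open>radix t b\<close>, written out because those are defined from this function. Parts in row
  \<open>b\<close> are below \<open>Suc b * t\<close>, so the value exceeds every quotient by the
  radix.\<close>

fun spill_bound :: "nat \<Rightarrow> nat \<Rightarrow> nat" where
  "spill_bound t 0 = 1"
| "spill_bound t (Suc b) =
     Suc b * t div (2 ^ ceillog2 (spill_bound t b * t) div spill_bound t b) + 1"

definition width :: "nat \<Rightarrow> nat \<Rightarrow> nat" where
  "width t b = ceillog2 (spill_bound t b * t)"

definition radix :: "nat \<Rightarrow> nat \<Rightarrow> nat" where
  "radix t b = 2 ^ width t b div spill_bound t b"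

lemma spill_bound_Suc: "spill_bound t (Suc b) = Suc b * t div radix t b + 1"
  by (simp add: radix_def width_def)

declare spill_bound.simps(2) [simp del]

lemma spill_bound_pos: "0 < spill_bound t b"
  by (cases b) (simp_all add: spill_bound_Suc)

section \<open>Estimates for the parameters of the spill-over chain\<close>

lemma radix_ge:
  assumes "0 < t"
  shows "t \<le> radix t b"
proof -
  have "spill_bound t b * t div spill_bound t b \<le> 2 ^ width t b div spill_bound t b"
    unfolding width_def by (intro div_le_mono le_two_power_ceillog2)
  then show ?thesis using spill_bound_pos[of t b] by (simp add: radix_def)
qed

lemma radix_pos: "0 < t \<Longrightarrow> 0 < radix t b"
  using radix_ge by (metis le_zero_eq not_gr_zero)

lemma two_power_width_less:
  assumes "0 < t"
  shows "2 ^ width t b < 2 * (spill_bound t b * t)"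
  unfolding width_def using assms spill_bound_pos[of t b] by (intro two_power_ceillog2_gt) auto

text \<open>Minimality of the width gives \<open>2 ^ M < 2 * Y * t\<close>, and division by
  \<open>Y\<close> gives the bound.\<close>

lemma radix_less:
  assumes "0 < t"
  shows "radix t b < 2 * t"
proof -
  have "2 ^ width t b < (2 * t) * spill_bound t b"
    using two_power_width_less[OF assms, of b] by (simp add: mult_ac)
  then show ?thesis unfolding radix_def by (rule less_mult_imp_div_less)
qed

lemma spill_bound_times_radix: "spill_bound t b * radix t b \<le> 2 ^ width t b"
  by (simp add: radix_def)

lemma two_power_width_less_spill_bound: "2 ^ width t b < spill_bound t b * (radix t b + 1)"
  unfolding radix_def using spill_bound_pos[of t b] dividend_less_times_div[of "spill_bound t b" "2 ^ width t b"]
  by (simp add: algebra_simps)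

text \<open>Since the radix is at least \<open>t\<close>, the quotient
  \<open>Suc a * t div radix t a\<close> is at most \<open>Suc a\<close>. Spills thus grow at most
  linearly with the row, which keeps the widths below the word size.\<close>

lemma spill_bound_le:
  assumes "0 < t"
  shows "spill_bound t b \<le> Suc b"
proof (cases b)
  case 0
  then show ?thesis by simp
next
  case (Suc a)
  have "Suc a * t div radix t a \<le> Suc a * t div t"
    using radix_ge[OF assms, of a] assms by (intro div_le_mono2) auto
  then show ?thesis using assms by (simp add: Suc spill_bound_Suc)
qed

lemma width_pos:
  assumes "1 < t"
  shows "0 < width t b"
proof (rule ccontr)
  assume "\<not> 0 < width t b"
  then have "radix t b \<le> 1" by (simp add: radix_def)
  then show False using radix_ge[of t b] assms by simp
qed

lemma quarter_pos: "0 < quarter n" and side_pos: "0 < side n"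
  by (simp_all add: quarter_def side_def)

text \<open>Counting down from \<open>n\<close> makes the item of index \<open>k\<close> at most
  \<open>k\<close>. Positions \<open>k \<ge> n\<close> of the last rows are filled with 0.\<close>

definition item :: "nat \<Rightarrow> (nat \<Rightarrow> nat) \<Rightarrow> nat \<Rightarrow> nat \<Rightarrow> nat" where
  "item n e b p = (let i = n - (b * side n + p) in if b * side n + p < n then e i - i else 0)"

definition spill :: "nat \<Rightarrow> (nat \<Rightarrow> nat) \<Rightarrow> nat \<Rightarrow> nat \<Rightarrow> nat" where
  "spill n e b p = (if b = 0 then 0 else item n e (b - 1) p div 4 div radix (quarter n) (b - 1))"

definition high_field :: "nat \<Rightarrow> (nat \<Rightarrow> nat) \<Rightarrow> nat \<Rightarrow> nat \<Rightarrow> nat" where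
  "high_field n e b p =
     spill n e b p * radix (quarter n) b + item n e b p div 4 mod radix (quarter n) b"

definition low_field :: "nat \<Rightarrow> (nat \<Rightarrow> nat) \<Rightarrow> nat \<Rightarrow> nat \<Rightarrow> nat" where
  "low_field n e b p = item n e b p mod 4"

definition high_length :: "nat \<Rightarrow> nat \<Rightarrow> nat \<Rightarrow> nat" where
  "high_length w n b = packed_length w (width (quarter n) b) (side n)"

definition row_words :: "nat \<Rightarrow> nat \<Rightarrow> (nat \<Rightarrow> nat) \<Rightarrow> nat \<Rightarrow> nat list" where
  "row_words w n e b =
     packed_array w (width (quarter n) b) (side n) (high_field n e b) @
     packed_array w 2 (side n) (low_field n e b)"

definition row_length :: "nat \<Rightarrow> nat \<Rightarrow> nat \<Rightarrow> nat" where
  "row_length w n b = high_length w n b + packed_length w 2 (side n)"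

text \<open>The offset consists of four header cells and four cells for each of the
  \<open>row_count n + 1\<close> table entries.\<close>

definition row_start :: "nat \<Rightarrow> nat \<Rightarrow> nat \<Rightarrow> nat" where
  "row_start w n b = 4 * (row_count n + 2) + (\<Sum>a<b. row_length w n a)"

definition table_entry :: "nat \<Rightarrow> nat \<Rightarrow> nat \<Rightarrow> nat list" where
  "table_entry w n b =
     [row_start w n b, width (quarter n) b, radix (quarter n) b, row_start w n b + high_length w n b]"

text \<open>The header is padded to four cells, so that the table entry of row \<open>b\<close>
  starts at address \<open>4 * b + 4\<close>.\<close>

definition large_memory :: "nat \<Rightarrow> nat \<Rightarrow> (nat \<Rightarrow> nat) \<Rightarrow> nat list" where
  "large_memory w n e =
     [n, side n, w, 0] @ concat (map (table_entry w n) [0..<row_count n + 1]) @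
     concat (map (row_words w n e) [0..<row_count n + 1])"

section \<open>Addressing the cells of the memory\<close>

lemma length_concat_map_upt:
  "length (concat (map f [0..<N])) = (\<Sum>a<N. length (f a))"
  by (induction N) simp_all

lemma concat_map_upt_nth:
  assumes "b < N" "j < length (f b)"
  shows "concat (map f [0..<N]) ! ((\<Sum>a<b. length (f a)) + j) = f b ! j"
  using assms
proof (induction N)
  case 0
  then show ?case by simp
next
  case (Suc N)
  show ?case
  proof (cases "b = N")
    case True
    then show ?thesis using Suc.prems by (simp add: nth_append length_concat_map_upt)
  next
    case False
    then have "b < N" using Suc.prems by simp
    then have "(\<Sum>a<Suc b. length (f a)) \<le> (\<Sum>a<N. length (f a))"
      by (intro sum_mono2) auto
    then have "(\<Sum>a<b. length (f a)) + j < (\<Sum>a<N. length (f a))"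
      using Suc.prems by simp
    then show ?thesis using Suc.IH[OF \<open>b < N\<close>] Suc.prems
      by (simp add: nth_append length_concat_map_upt)
  qed
qed

lemma length_row_words [simp]: "length (row_words w n e b) = row_length w n b"
  by (simp add: row_words_def row_length_def high_length_def)

lemma length_table_entry [simp]: "length (table_entry w n b) = 4"
  by (simp add: table_entry_def)

lemma length_large_memory: "length (large_memory w n e) = row_start w n (row_count n + 1)"
  by (simp add: large_memory_def length_concat_map_upt row_start_def del: upt_Suc sum.lessThan_Suc)

lemma row_start_mono:
  assumes "b \<le> row_count n"
  shows "row_start w n b + row_length w n b \<le> row_start w n (row_count n + 1)"
proof -
  have "(\<Sum>a<Suc b. row_length w n a) \<le> (\<Sum>a<row_count n + 1. row_length w n a)"
    using assms by (intro sum_mono2) auto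
  then show ?thesis by (simp add: row_start_def)
qed

lemma large_memory_header:
  "large_memory w n e ! 0 = n" "large_memory w n e ! Suc 0 = side n" "large_memory w n e ! 2 = w"
  by (simp_all add: large_memory_def)

lemma large_memory_table:
  assumes "b \<le> row_count n" "c < 4"
  shows "large_memory w n e ! (b * 4 + 4 + c) = table_entry w n b ! c"
proof -
  have "b * 4 + c < (row_count n + 1) * 4" using assms by simp
  moreover have "concat (map (table_entry w n) [0..<row_count n + 1]) ! (b * 4 + c) = table_entry w n b ! c"
    using concat_map_upt_nth[of b "row_count n + 1" c "table_entry w n"] assms
    by (simp del: upt_Suc)
  ultimately have "(concat (map (table_entry w n) [0..<row_count n + 1]) @ rest) ! (b * 4 + c) =
      table_entry w n b ! c" for rest
    by (simp add: nth_append length_concat_map_upt del: upt_Suc)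
  then show ?thesis by (simp add: large_memory_def nth_append del: upt_Suc)
qed

lemma large_memory_row:
  assumes "b \<le> row_count n" "j < row_length w n b"
  shows "large_memory w n e ! (row_start w n b + j) = row_words w n e b ! j"
proof -
  have "concat (map (row_words w n e) [0..<row_count n + 1]) ! ((\<Sum>a<b. row_length w n a) + j) = row_words w n e b ! j"
    using concat_map_upt_nth[of b "row_count n + 1" j "row_words w n e"] assms by (simp del: upt_Suc)
  then show ?thesis
    by (simp add: large_memory_def row_start_def nth_append length_concat_map_upt del: upt_Suc)
qed

lemma large_memory_high:
  assumes "b \<le> row_count n" "j < high_length w n b"
  shows "large_memory w n e ! (row_start w n b + j) =
    packed_word w (width (quarter n) b) (high_field n e b) j"
  using large_memory_row[of b n j w e] assms
  by (simp add: row_length_def row_words_def nth_append packed_array_nth high_length_def)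

lemma large_memory_low:
  assumes "b \<le> row_count n" "j < packed_length w 2 (side n)"
  shows "large_memory w n e ! (row_start w n b + high_length w n b + j) =
    packed_word w 2 (low_field n e b) j"
  using large_memory_row[of b n "high_length w n b + j" w e] assms
  by (simp add: row_length_def row_words_def nth_append packed_array_nth high_length_def add.assoc)

lemma packed_index_less:
  assumes "p < s"
  shows "p * M div w + 1 < packed_length w M s"
proof -
  have "p * M div w \<le> s * M div w" using assms by (intro div_le_mono mult_right_mono) auto
  then show ?thesis by (simp add: packed_length_def)
qed

section \<open>Field bounds and decoding\<close>

lemma item_le:
  assumes "\<forall>i\<in>{1..n}. e i \<in> {i..n}"
  shows "item n e b p \<le> b * side n + p"
proof (cases "b * side n + p < n")
  case True
  define k where "k = b * side n + p"
  have "e (n - k) \<in> {n - k..n}" using True by (intro bspec[OF assms]) (auto simp: k_def)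
  then have "e (n - k) - (n - k) \<le> k" by (simp, linarith)
  then show ?thesis using True by (simp add: item_def Let_def flip: k_def)
next
  case False
  then show ?thesis by (simp add: item_def Let_def)
qed

text \<open>Items of row \<open>b\<close> are below \<open>Suc b * (4 * t)\<close>; the factor four
  in \<open>side\<close> makes the division by four exact here.\<close>

lemma item_div_less:
  assumes "\<forall>i\<in>{1..n}. e i \<in> {i..n}" "p < side n"
  shows "item n e b p div 4 < Suc b * quarter n"
proof -
  have "item n e b p < Suc b * side n" using item_le[OF assms(1), of b p] assms(2) by simp
  then show ?thesis unfolding side_def by (intro less_mult_imp_div_less) (simp add: algebra_simps)
qed

lemma spill_less:
  assumes "\<forall>i\<in>{1..n}. e i \<in> {i..n}" "p < side n"
  shows "spill n e b p < spill_bound (quarter n) b"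
proof (cases b)
  case 0
  then show ?thesis by (simp add: spill_def)
next
  case (Suc a)
  have "item n e a p div 4 div radix (quarter n) a \<le> Suc a * quarter n div radix (quarter n) a"
    using item_div_less[OF assms, of a] by (intro div_le_mono) simp
  then show ?thesis by (simp add: Suc spill_def spill_bound_Suc)
qed

text \<open>With \<open>y < Y\<close> and a remainder below \<open>C\<close>, the value
  \<open>y * C\<close> plus the remainder is below \<open>Y * C\<close>, and \<open>C\<close> was
  chosen with \<open>Y * C \<le> 2 ^ M\<close>.\<close>

lemma high_field_less:
  assumes "\<forall>i\<in>{1..n}. e i \<in> {i..n}" "p < side n"
  shows "high_field n e b p < 2 ^ width (quarter n) b"
proof -
  let ?C = "radix (quarter n) b"
  have "high_field n e b p < Suc (spill n e b p) * ?C"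
    using radix_pos[OF quarter_pos] by (simp add: high_field_def)
  also have "\<dots> \<le> spill_bound (quarter n) b * ?C"
    using spill_less[OF assms, of b] by (intro mult_right_mono) auto
  also have "\<dots> \<le> 2 ^ width (quarter n) b" by (rule spill_bound_times_radix)
  finally show ?thesis .
qed

text \<open>The spill of a row is recovered from the next row alone, so decoding does not recurse.\<close>

lemma item_decode:
  "high_field n e (Suc b) p div radix (quarter n) (Suc b) * radix (quarter n) b +
     high_field n e b p mod radix (quarter n) b = item n e b p div 4"
proof -
  have "high_field n e (Suc b) p div radix (quarter n) (Suc b) = spill n e (Suc b) p"
    using radix_pos[OF quarter_pos, of n "Suc b"] by (simp add: high_field_def)
  then show ?thesis by (simp add: high_field_def[of n e b] spill_def[of n e "Suc b"] div_mult_mod_eq)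
qed

lemma low_field_less: "low_field n e b p < 2 ^ 2"
  by (simp add: low_field_def)

lemma item_eq:
  assumes "i \<in> {1..n}"
  shows "item n e ((n - i) div side n) ((n - i) mod side n) = e i - i"
  using assms by (auto simp: item_def Let_def)

text \<open>These conditions exclude every overflow of the query program.\<close>

definition large :: "nat \<Rightarrow> nat \<Rightarrow> bool" where
  "large w n \<longleftrightarrow> 0 < n \<and> n < 2 ^ w \<and> 3 \<le> w \<and> side n * w < 2 ^ w \<and>
     row_start w n (row_count n + 1) \<le> 2 ^ w \<and> (\<forall>b\<le>row_count n. width (quarter n) b < w)"

text \<open>The first cell tells the two layouts apart: it is \<open>n > 0\<close> in the compact
  one and 0 in the plain one, where it also puts \<open>e i\<close> at address \<open>i\<close>.
  Under the assumptions of the theorem the plain layout occurs for finitely many \<open>n\<close>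
  only.\<close>

definition memory :: "nat \<Rightarrow> nat \<Rightarrow> (nat \<Rightarrow> nat) \<Rightarrow> nat list" where
  "memory w n e = (if large w n then large_memory w n e else 0 # map e [1..<n + 1])"

definition memory_length :: "nat \<Rightarrow> nat \<Rightarrow> nat" where
  "memory_length w n = (if large w n then row_start w n (row_count n + 1) else n + 1)"

lemma length_memory: "length (memory w n e) = memory_length w n"
  by (simp add: memory_def memory_length_def length_large_memory)

lemma row_start_less:
  assumes "large w n" "b \<le> row_count n"
  shows "row_start w n b + high_length w n b < 2 ^ w"
proof -
  have "row_start w n b + row_length w n b \<le> 2 ^ w"
    using row_start_mono[OF assms(2), of w] assms(1) by (simp add: large_def)
  then show ?thesis by (simp add: row_length_def packed_length_def)
qed

lemma radix_less_two_power:
  assumes "large w n" "b \<le> row_count n"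
  shows "radix (quarter n) b < 2 ^ w"
proof -
  have "radix (quarter n) b \<le> 2 ^ width (quarter n) b"
    unfolding radix_def by (rule div_le_dividend)
  also have "\<dots> < 2 ^ w" using assms by (simp add: large_def)
  finally show ?thesis .
qed

lemma side_less:
  assumes "large w n"
  shows "side n < 2 ^ w"
proof -
  have "0 < w" using assms by (simp add: large_def)
  then have "side n \<le> side n * w" by simp
  also have "\<dots> < 2 ^ w" using assms by (simp add: large_def)
  finally show ?thesis .
qed

lemma memory_words:
  assumes "n < 2 ^ w" "\<forall>i\<in>{1..n}. e i \<in> {i..n}" "x \<in> set (memory w n e)"
  shows "x < 2 ^ w"
proof (cases "large w n")
  case False
  then have "x = 0 \<or> (\<exists>i\<in>{1..n}. x = e i)" using assms(3) by (auto simp: memory_def)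
  moreover have "e i < 2 ^ w" if "i \<in> {1..n}" for i
    using bspec[OF assms(2) that] assms(1) by simp
  ultimately show ?thesis by auto
next
  case True
  have "w < 2 ^ w" by (rule less_exp)
  have "x < 2 ^ w" if "x \<in> set (table_entry w n b)" "b \<le> row_count n" for b
  proof -
    have "width (quarter n) b < w" using that True by (simp add: large_def)
    then have "width (quarter n) b < 2 ^ w" using \<open>w < 2 ^ w\<close> by (rule less_trans)
    then show ?thesis
      using that row_start_less[OF True, of b] radix_less_two_power[OF True, of b]
      by (auto simp: table_entry_def)
  qed
  moreover have "x < 2 ^ w" if "x \<in> set (row_words w n e b)" for b
    using that packed_word_less by (auto simp: row_words_def packed_array_def)
  ultimately show ?thesis
    using assms True side_less[OF True] \<open>w < 2 ^ w\<close>
    by (auto simp: memory_def large_memory_def simp del: upt_Suc)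
qed

section \<open>The query program\<close>

text \<open>Register 9 is always 0; in the decoding part register 10 holds 1, register 5 the column and
  register 6 the word size. Registers 20 and 21 are scratch registers.\<close>

definition load_offset :: "nat \<Rightarrow> nat \<Rightarrow> nat \<Rightarrow> instr list" where
  "load_offset r a c = [LITERAL 20 c, BINOP ADD 20 a 20, LOAD r 20]"

text \<open>Registers \<open>a\<close> and \<open>l\<close> hold the start address and the field
  width. The field whose index is in register 5 ends up in register \<open>r\<close>, computed as in
  \<open>extract_field\<close>.\<close>

definition read_field :: "nat \<Rightarrow> nat \<Rightarrow> nat \<Rightarrow> instr list" where
  "read_field a l r =
    [BINOP MUL 20 5 l, BINOP DIV 21 20 6, BINOP MOD 20 20 6, BINOP ADD 21 21 a,
     LOAD r 21, BINOP ADD 21 21 10, LOAD 21 21,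
     BINOP SHR r r 20, BINOP SUB 20 6 20, BINOP SHL 21 21 20, BINOP OR r r 21,
     BINOP SUB 20 6 l, BINOP SHL r r 20, BINOP SHR r r 20]"

text \<open>On entry registers 0 and 2 hold \<open>i\<close> and \<open>n\<close>; on exit register
  3 holds \<open>e i\<close>. Register 4 points to the table entry of the row of \<open>i\<close>,
  registers 11 to 14 receive that entry, and 15 to 17 the start, width and radix of the next
  row.\<close>

definition decode_endpoint :: "instr list" where
  "decode_endpoint =
    load_offset 3 9 1 @ load_offset 6 9 2 @
    [LITERAL 10 1, LITERAL 7 4, LITERAL 8 2,
     BINOP SUB 4 2 0, BINOP MOD 5 4 3, BINOP DIV 4 4 3, BINOP MUL 4 4 7, BINOP ADD 4 4 7] @
    load_offset 11 4 0 @ load_offset 12 4 1 @ load_offset 13 4 2 @ load_offset 14 4 3 @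
    load_offset 15 4 4 @ load_offset 16 4 5 @ load_offset 17 4 6 @
    read_field 11 12 18 @ read_field 15 16 19 @ read_field 14 8 22 @
    [BINOP DIV 19 19 17, BINOP MUL 19 19 13, BINOP MOD 18 18 13, BINOP ADD 19 19 18,
     BINOP MUL 19 19 7, BINOP ADD 19 19 22, BINOP ADD 3 19 0]"

text \<open>Positions 2 to 4 swap the arguments, \<open>OR\<close> of a register with itself serving
  as a copy. Position 6 chooses between the decoder at 13 and the direct lookup at 7; both continue
  with the comparison at 8.\<close>

definition adjacency_program :: "instr list" where
  "adjacency_program =
    [JUMP_EQ 0 1 11, JUMP_LESS 0 1 5, BINOP OR 2 0 0, BINOP OR 0 1 1, BINOP OR 1 2 2,
     LOAD 2 9, JUMP_LESS 9 2 13, LOAD 3 0,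
     JUMP_LESS 3 1 11, LITERAL 0 1, HALT, LITERAL 0 0, HALT] @
    decode_endpoint @ [JUMP 8]"

section \<open>Symbolic execution of the decoder\<close>

lemma straight_load_offset:
  assumes "\<rho> a + c < length m" "length m \<le> 2 ^ w" "a \<noteq> 20"
  shows "straight w m (load_offset r a c @ is) \<rho> =
    straight w m is (\<rho>(20 := \<rho> a + c, r := m ! (\<rho> a + c)))"
  using assms by (simp add: load_offset_def)

lemma sub_mod_two_power:
  fixes a b :: nat
  assumes "b \<le> a" "a < 2 ^ w"
  shows "(a + 2 ^ w - b) mod 2 ^ w = a - b"
proof -
  have "a + 2 ^ w - b = (a - b) + 2 ^ w" "a - b < 2 ^ w" using assms by simp_all
  then show ?thesis by (simp only: mod_add_self2 mod_less)
qed

text \<open>The existential quantifiers hide what remains in the scratch registers. The bounds on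
  \<open>p * M\<close> and on the length of \<open>m\<close> exclude wrap-around in the bit position
  and in the addresses.\<close>

lemma straight_read_field:
  assumes "\<rho> 5 = p" "\<rho> 6 = w" "\<rho> 10 = 1" "\<rho> a = A" "\<rho> l = M"
    and "a \<notin> {20, 21, r}" "l \<notin> {20, 21, r}" "r \<notin> {6, 20, 21, 10}"
    and "p * M < 2 ^ w" "0 < M" "M \<le> w" "A + (p * M div w + 1) < length m" "length m \<le> 2 ^ w"
    and "\<And>j. j \<le> p * M div w + 1 \<Longrightarrow> m ! (A + j) = packed_word w M f j"
    and "f p < 2 ^ M"
  shows "\<exists>x y. straight w m (read_field a l r @ is) \<rho> = straight w m is (\<rho>(20 := x, 21 := y, r := f p))"
proof -
  define q where "q = p * M div w"
  have w: "w < 2 ^ w" by (rule less_exp)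
  have "p * M mod w < w" using assms by simp
  then have sub: "(w + 2 ^ w - p * M mod w) mod 2 ^ w = w - p * M mod w"
    using w by (intro sub_mod_two_power) auto
  have sub2: "(w + 2 ^ w - M) mod 2 ^ w = w - M"
    using w assms by (intro sub_mod_two_power) auto
  have len: "A + (q + 1) < length m" using assms by (simp add: q_def)
  have m: "m ! (A + q) = packed_word w M f q" "m ! (A + (q + 1)) = packed_word w M f (q + 1)"
    using assms(14)[of q] assms(14)[of "q + 1"] by (simp_all add: q_def)
  define x where "x = w - M"
  define y where "y = push_bit (w - p * M mod w) (packed_word w M f (q + 1)) mod 2 ^ w"
  have field: "extract_field w M (p * M mod w) (packed_word w M f q) (packed_word w M f (q + 1)) = f p"
    unfolding q_def using assms by (intro extract_packed_word) auto
  have addr: "(q + A) mod 2 ^ w = A + q" "(A + q + 1) mod 2 ^ w = A + (q + 1)"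
    "A + q < length m"
    using len assms(13) by simp_all
  have "straight w m (read_field a l r @ is) \<rho> = straight w m is (\<rho>(20 := x, 21 := y, r := f p))"
  proof -
    have "straight w m (read_field a l r @ is) \<rho> =
      straight w m is (\<rho>(20 := x, 21 := y,
        r := extract_field w M (p * M mod w) (packed_word w M f q) (packed_word w M f (q + 1))))"
      using assms(1-9) len m sub sub2 addr
      by (simp add: read_field_def extract_field_def x_def y_def fun_upd_twist flip: q_def)
    then show ?thesis by (simp only: field)
  qed
  then show ?thesis by blast
qed

text \<open>Three field reads supply the inputs of \<open>item_decode\<close> and the two low bits.
  Register 1 is tracked because the later comparison needs the other vertex.\<close>

lemma straight_decode_endpoint:
  fixes \<rho> :: "nat \<Rightarrow> nat"
  assumes e: "\<forall>i\<in>{1..n}. e i \<in> {i..n}" and L: "large w n" and i: "i \<in> {1..n}"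
    and \<rho>: "\<rho> 0 = i" "\<rho> 2 = n" "\<rho> 9 = 0"
  shows "\<exists>\<rho>'. straight w (large_memory w n e) decode_endpoint \<rho> = Some \<rho>' \<and>
    \<rho>' 3 = e i \<and> \<rho>' 1 = \<rho> 1"
proof -
  define m where "m = large_memory w n e"
  define s where "s = side n"
  define t where "t = quarter n"
  define b where "b = (n - i) div s"
  define p where "p = (n - i) mod s"
  define A where "A = b * 4 + 4"
  have n: "0 < n" "n < 2 ^ w" and w3: "3 \<le> w" and sw: "s * w < 2 ^ w"
    using L by (auto simp: large_def s_def)
  have "p < s" using side_pos[of n] by (simp add: p_def s_def)
  \<comment> \<open>The successor row must be in the table too, because it holds the spill of row
    \<open>b\<close>.\<close>
  have b: "b \<le> row_count n" "Suc b \<le> row_count n"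
    using div_le_mono[of "n - i" n s] by (simp_all add: b_def row_count_def s_def)
  have lenm: "length m = row_start w n (row_count n + 1)" "length m \<le> 2 ^ w"
    using L by (simp_all add: m_def length_large_memory large_def)
  have head: "(row_count n + 2) * 4 \<le> length m"
    by (simp add: lenm row_start_def)
  have tab: "A + c < length m" if "c < 8" for c
    using that b head by (simp add: A_def)
  have table: "m ! (A + c) = table_entry w n b ! c" "m ! (A + (4 + c)) = table_entry w n (Suc b) ! c"
    if "c < 4" for c
    using large_memory_table[OF b(1) that, of w e] large_memory_table[OF b(2) that, of w e]
    by (simp_all add: A_def m_def algebra_simps)
  have "(8::nat) \<le> 2 ^ w" using power_increasing[OF w3, of "2::nat"] by simp
  then have lits: "1 mod 2 ^ w = (1::nat)" "4 mod 2 ^ w = (4::nat)" "2 mod 2 ^ w = (2::nat)"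
    using w3 by simp_all
  have A: "(b * 4) mod 2 ^ w = b * 4" "(b * 4 + 4) mod 2 ^ w = A"
    using tab[of 0] lenm(2) by (simp_all add: A_def)
  have k: "(n + 2 ^ w - i) mod 2 ^ w = n - i"
    using i n by (intro sub_mod_two_power) auto
  define Q where "Q = row_start w n b"
  define M where "M = width t b"
  define C where "C = radix t b"
  define Q1 where "Q1 = row_start w n (Suc b)"
  define M1 where "M1 = width t (Suc b)"
  define C1 where "C1 = radix t (Suc b)"
  define Q2 where "Q2 = row_start w n b + high_length w n b"
  define \<rho>1 where "\<rho>1 = \<rho>(3 := s, 6 := w, 10 := 1, 7 := 4, 8 := 2, 5 := p, 4 := A,
      11 := Q, 12 := M, 13 := C, 14 := Q2, 15 := Q1, 16 := M1, 17 := C1, 20 := A + 6)"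
  have hd: "m ! 0 = n" "m ! Suc 0 = s" "m ! Suc (Suc 0) = w"
    by (simp_all add: m_def s_def large_memory_header flip: numeral_2_eq_2)
  have tb: "m ! A = Q" "m ! (A + 1) = M" "m ! (A + 2) = C" "m ! (A + 3) = Q2"
    "m ! (A + 4) = Q1" "m ! (A + 5) = M1" "m ! (A + 6) = C1"
    using table(1)[of 0] table(1)[of 1] table(1)[of 2] table(1)[of 3]
      table(2)[of 0] table(2)[of 1] table(2)[of 2]
    by (simp_all add: table_entry_def Q_def M_def C_def Q1_def M1_def C1_def Q2_def t_def)
  have tl: "A < length m" "A + 1 < length m" "A + 2 < length m" "A + 3 < length m"
    "A + 4 < length m" "A + 5 < length m" "A + 6 < length m" "Suc 0 < length m" "Suc (Suc 0) < length m"
    using tab[of 0] tab[of 1] tab[of 2] tab[of 3] tab[of 4] tab[of 5] tab[of 6]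
    by (simp_all add: A_def)
  define final where "final = [BINOP DIV 19 19 17, BINOP MUL 19 19 13, BINOP MOD 18 18 13,
     BINOP ADD 19 19 18, BINOP MUL 19 19 7, BINOP ADD 19 19 22, BINOP ADD 3 19 0]"
  have 1: "straight w m decode_endpoint \<rho> = straight w m
      (read_field 11 12 18 @ read_field 15 16 19 @ read_field 14 8 22 @ final) \<rho>1"
    unfolding decode_endpoint_def final_def[symmetric]
    using \<rho> hd tb tl lits A k lenm(2)
    by (simp add: straight_load_offset \<rho>1_def fun_upd_twist flip: b_def p_def)
  \<comment> \<open>From \<open>n > 0\<close> follows \<open>t \<ge> 2\<close>, hence the widths are
    positive.\<close>
  have Mb: "0 < M" "M < w" "0 < M1" "M1 < w"
    using L b n width_pos[of t] by (auto simp: M_def M1_def large_def t_def quarter_def)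
  have mult: "p * M' < 2 ^ w" if "M' \<le> w" for M'
  proof -
    have "p * M' \<le> s * w" using that \<open>p < s\<close> by (intro mult_mono) auto
    then show ?thesis using sw by simp
  qed
  have bound: "row_start w n b' + row_length w n b' \<le> length m" if "b' \<le> row_count n" for b'
    using row_start_mono[OF that, of w] by (simp add: lenm)
  have idx: "p * M' div w + 1 < packed_length w M' s" for M'
    using \<open>p < s\<close> by (rule packed_index_less)
  obtain x1 y1 where 2: "straight w m
      (read_field 11 12 18 @ read_field 15 16 19 @ read_field 14 8 22 @ final) \<rho>1 =
      straight w m (read_field 15 16 19 @ read_field 14 8 22 @ final)
        (\<rho>1(20 := x1, 21 := y1, 18 := high_field n e b p))"
  proof -
    have "\<exists>x y. straight w m
      (read_field 11 12 18 @ read_field 15 16 19 @ read_field 14 8 22 @ final) \<rho>1 =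
      straight w m (read_field 15 16 19 @ read_field 14 8 22 @ final)
        (\<rho>1(20 := x, 21 := y, 18 := high_field n e b p))"
    proof (rule straight_read_field[where A = Q and M = M and p = p and f = "high_field n e b"])
      show "Q + (p * M div w + 1) < length m"
        using bound[OF b(1)] idx[of M] by (simp add: Q_def row_length_def high_length_def M_def t_def s_def)
      show "m ! (Q + j) = packed_word w M (high_field n e b) j" if "j \<le> p * M div w + 1" for j
        unfolding m_def Q_def M_def t_def using that idx[of M]
        by (intro large_memory_high b(1)) (simp add: high_length_def M_def t_def s_def)
      show "high_field n e b p < 2 ^ M"
        unfolding M_def t_def by (rule high_field_less[OF e]) (use \<open>p < s\<close> s_def in simp)
    qed (use Mb lenm mult in \<open>auto simp: \<rho>1_def\<close>)
    then show ?thesis using that by blast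
  qed
  obtain x2 y2 where 3: "straight w m (read_field 15 16 19 @ read_field 14 8 22 @ final)
        (\<rho>1(20 := x1, 21 := y1, 18 := high_field n e b p)) =
      straight w m (read_field 14 8 22 @ final)
        (\<rho>1(20 := x1, 21 := y1, 18 := high_field n e b p, 20 := x2, 21 := y2,
            19 := high_field n e (Suc b) p))"
  proof -
    have "\<exists>x y. straight w m (read_field 15 16 19 @ read_field 14 8 22 @ final)
        (\<rho>1(20 := x1, 21 := y1, 18 := high_field n e b p)) =
      straight w m (read_field 14 8 22 @ final)
        (\<rho>1(20 := x1, 21 := y1, 18 := high_field n e b p, 20 := x, 21 := y,
            19 := high_field n e (Suc b) p))"
    proof (rule straight_read_field[where A = Q1 and M = M1 and p = p and f = "high_field n e (Suc b)"])
      show "Q1 + (p * M1 div w + 1) < length m"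
        using bound[OF b(2)] idx[of M1] by (simp add: Q1_def row_length_def high_length_def M1_def t_def s_def)
      show "m ! (Q1 + j) = packed_word w M1 (high_field n e (Suc b)) j" if "j \<le> p * M1 div w + 1" for j
        unfolding m_def Q1_def M1_def t_def using that idx[of M1]
        by (intro large_memory_high b) (simp add: high_length_def M1_def t_def s_def)
      show "high_field n e (Suc b) p < 2 ^ M1"
        unfolding M1_def t_def by (rule high_field_less[OF e]) (use \<open>p < s\<close> s_def in simp)
    qed (use Mb lenm mult in \<open>auto simp: \<rho>1_def\<close>)
    then show ?thesis using that by blast
  qed
  define \<rho>2 where "\<rho>2 = \<rho>1(20 := x1, 21 := y1, 18 := high_field n e b p, 20 := x2, 21 := y2,
            19 := high_field n e (Suc b) p)"
  obtain x3 y3 where 4: "straight w m (read_field 14 8 22 @ final) \<rho>2 =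
      straight w m final (\<rho>2(20 := x3, 21 := y3, 22 := low_field n e b p))"
  proof -
    have "\<exists>x y. straight w m (read_field 14 8 22 @ final) \<rho>2 =
      straight w m final (\<rho>2(20 := x, 21 := y, 22 := low_field n e b p))"
    proof (rule straight_read_field[where A = Q2 and M = 2 and p = p and f = "low_field n e b"])
      show "Q2 + (p * 2 div w + 1) < length m"
        using bound[OF b(1)] idx[of 2] by (simp add: Q2_def row_length_def s_def)
      show "m ! (Q2 + j) = packed_word w 2 (low_field n e b) j" if "j \<le> p * 2 div w + 1" for j
        unfolding m_def Q2_def using that idx[of 2]
        by (intro large_memory_low b) (simp add: s_def)
      show "low_field n e b p < 2 ^ 2"
        by (rule low_field_less)
    qed (use w3 lenm mult in \<open>auto simp: \<rho>2_def \<rho>1_def\<close>)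
    then show ?thesis using that by blast
  qed
  define x where "x = item n e b p"
  define z where "z = high_field n e (Suc b) p div C1"
  define y where "y = high_field n e b p mod C"
  have dec: "z * C + y = x div 4"
    unfolding z_def y_def x_def C_def C1_def t_def by (rule item_decode)
  have xe: "x = e i - i"
    unfolding x_def b_def p_def s_def by (rule item_eq[OF i])
  have ei: "i \<le> e i" "e i < 2 ^ w" using bspec[OF e i] n by auto
  have small: "z * C + y \<le> x" "x < 2 ^ w" "x div 4 * 4 \<le> x" "x div 4 * 4 + x mod 4 = x"
    using ei by (simp_all add: dec xe)
  \<comment> \<open>Every intermediate value is at most \<open>e i < 2 ^ w\<close>, so the final
    arithmetic does not wrap around.\<close>
  have mods: "z * C mod 2 ^ w = z * C" "(z * C + y) mod 2 ^ w = x div 4"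
    "(x div 4 * 4) mod 2 ^ w = x div 4 * 4" "(x div 4 * 4 + x mod 4) mod 2 ^ w = x"
    "(x + i) mod 2 ^ w = e i"
  proof -
    have "z * C < 2 ^ w" "z * C + y < 2 ^ w" using small by linarith+
    then show "z * C mod 2 ^ w = z * C" "(z * C + y) mod 2 ^ w = x div 4"
      by (simp_all add: dec[symmetric])
    have "x div 4 * 4 < 2 ^ w" using small by linarith
    then show "(x div 4 * 4) mod 2 ^ w = x div 4 * 4" by simp
    show "(x div 4 * 4 + x mod 4) mod 2 ^ w = x" using small by simp
    show "(x + i) mod 2 ^ w = e i" using ei by (simp add: xe)
  qed
  have low: "low_field n e b p = x mod 4" by (simp add: low_field_def x_def)
  have "\<exists>\<rho>'. straight w m final (\<rho>2(20 := x3, 21 := y3, 22 := low_field n e b p)) = Some \<rho>' \<and>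
      \<rho>' 3 = e i \<and> \<rho>' 1 = \<rho> 1"
    unfolding final_def \<rho>2_def \<rho>1_def low
    using mods \<rho>(1) by (simp flip: z_def y_def)
  then show ?thesis
    using 1 2 3 4 by (simp only: m_def \<rho>2_def)
qed


section \<open>Runs of the whole program with step bounds\<close>

definition reaches :: "nat \<Rightarrow> nat \<Rightarrow> config \<Rightarrow> config \<Rightarrow> bool" where
  "reaches w T c c' \<longleftrightarrow> (\<exists>t\<le>T. (step w adjacency_program ^^ t) c c')"

lemma reaches_refl: "reaches w T c c"
  by (auto simp: reaches_def intro: exI[of _ 0])

lemma reaches_mono:
  assumes "reaches w T c c'" "T \<le> T'"
  shows "reaches w T' c c'"
  using assms unfolding reaches_def by (meson le_trans)

lemma reaches_step:
  assumes "step w adjacency_program c c'" "reaches w T c' c''"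
  shows "reaches w (Suc T) c c''"
  using assms unfolding reaches_def by (meson Suc_le_mono relpowp_Suc_I2)

lemma reaches_trans:
  assumes "reaches w T c c'" "reaches w T' c' c''"
  shows "reaches w (T + T') c c''"
  using assms unfolding reaches_def by (metis add_mono relpowp_trans)

lemma length_decode_endpoint: "length decode_endpoint = 84"
  by (simp add: decode_endpoint_def load_offset_def read_field_def)

lemma adjacency_program_nth:
  "adjacency_program ! 0 = JUMP_EQ 0 1 11"
  "adjacency_program ! 1 = JUMP_LESS 0 1 5"
  "adjacency_program ! 2 = BINOP OR 2 0 0"
  "adjacency_program ! 3 = BINOP OR 0 1 1"
  "adjacency_program ! 4 = BINOP OR 1 2 2"
  "adjacency_program ! 5 = LOAD 2 9"
  "adjacency_program ! 6 = JUMP_LESS 9 2 13"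
  "adjacency_program ! 7 = LOAD 3 0"
  "adjacency_program ! 8 = JUMP_LESS 3 1 11"
  "adjacency_program ! 9 = LITERAL 0 1"
  "adjacency_program ! 10 = HALT"
  "adjacency_program ! 11 = LITERAL 0 0"
  "adjacency_program ! 12 = HALT"
  "adjacency_program ! 97 = JUMP 8"
  "length adjacency_program = 98"
  by (simp_all add: adjacency_program_def length_decode_endpoint nth_append)

lemma reaches_instr:
  assumes "reaches w T c' c''" "pc c < 98" "exec_instr w (adjacency_program ! pc c) c = Some c'"
  shows "reaches w (Suc T) c c''"
  by (rule reaches_step[OF _ assms(1)]) (use assms in \<open>simp add: step_def adjacency_program_nth\<close>)

definition answered :: "nat list \<Rightarrow> bool \<Rightarrow> config \<Rightarrow> bool" where
  "answered m b c \<longleftrightarrow> halted adjacency_program c \<and> mem c = m \<and> regs c 0 = (if b then 1 else 0)"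

lemma answer_no:
  "\<exists>c. reaches w 1 \<lparr>pc = 11, regs = \<rho>, mem = m\<rparr> c \<and> answered m False c"
proof -
  have "reaches w (Suc 0) \<lparr>pc = 11, regs = \<rho>, mem = m\<rparr> \<lparr>pc = 12, regs = \<rho>(0 := 0), mem = m\<rparr>"
    by (rule reaches_instr[OF reaches_refl]) (simp_all add: adjacency_program_nth set_reg_def)
  moreover have "answered m False \<lparr>pc = 12, regs = \<rho>(0 := 0), mem = m\<rparr>"
    by (simp add: answered_def halted_def adjacency_program_nth)
  ultimately show ?thesis by auto
qed

lemma answer_yes:
  assumes "0 < w"
  shows "\<exists>c. reaches w 1 \<lparr>pc = 9, regs = \<rho>, mem = m\<rparr> c \<and> answered m True c"
proof -
  have "reaches w (Suc 0) \<lparr>pc = 9, regs = \<rho>, mem = m\<rparr> \<lparr>pc = 10, regs = \<rho>(0 := 1), mem = m\<rparr>"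
    by (rule reaches_instr[OF reaches_refl]) (use assms in \<open>simp_all add: adjacency_program_nth set_reg_def\<close>)
  moreover have "answered m True \<lparr>pc = 10, regs = \<rho>(0 := 1), mem = m\<rparr>"
    by (simp add: answered_def halted_def adjacency_program_nth)
  ultimately show ?thesis by auto
qed

lemma compare_endpoint:
  assumes "0 < w"
  shows "\<exists>c. reaches w 2 \<lparr>pc = 8, regs = \<rho>, mem = m\<rparr> c \<and> answered m (\<rho> 1 \<le> \<rho> 3) c"
proof (cases "\<rho> 1 \<le> \<rho> 3")
  case True
  obtain c where c: "reaches w 1 \<lparr>pc = 9, regs = \<rho>, mem = m\<rparr> c" "answered m True c"
    using answer_yes[OF assms] by blast
  have "reaches w (Suc 1) \<lparr>pc = 8, regs = \<rho>, mem = m\<rparr> c"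
    by (rule reaches_instr[OF c(1)]) (use True in \<open>simp_all add: adjacency_program_nth\<close>)
  then show ?thesis using c True by (auto simp: numeral_2_eq_2)
next
  case False
  obtain c where c: "reaches w 1 \<lparr>pc = 11, regs = \<rho>, mem = m\<rparr> c" "answered m False c"
    using answer_no by blast
  have "reaches w (Suc 1) \<lparr>pc = 8, regs = \<rho>, mem = m\<rparr> c"
    by (rule reaches_instr[OF c(1)]) (use False in \<open>simp_all add: adjacency_program_nth\<close>)
  then show ?thesis using c False by (auto simp: numeral_2_eq_2)
qed

text \<open>The longest path takes 89 steps: one load, one branch, 84 decoding instructions, one
  jump back, and two for the comparison and the answer.\<close>

lemma answer_ordered:
  fixes \<rho> :: "nat \<Rightarrow> nat"
  assumes e: "\<forall>i\<in>{1..n}. e i \<in> {i..n}" and n: "n < 2 ^ w" and i: "i \<in> {1..n}"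
    and \<rho>: "\<rho> 0 = i" "\<rho> 9 = 0"
  shows "\<exists>c. reaches w 90 \<lparr>pc = 5, regs = \<rho>, mem = memory w n e\<rparr> c \<and>
    answered (memory w n e) (\<rho> 1 \<le> e i) c"
proof -
  define m where "m = memory w n e"
  have w: "0 < w" using n i by (cases w) auto
  have "0 < length m" by (simp add: m_def memory_def large_memory_def)
  define \<rho>1 where "\<rho>1 = \<rho>(2 := m ! 0)"
  have fetch: "reaches w (Suc T) \<lparr>pc = 5, regs = \<rho>, mem = m\<rparr> c"
    if "reaches w T \<lparr>pc = 6, regs = \<rho>1, mem = m\<rparr> c" for T c
    by (rule reaches_instr[OF that])
      (use \<open>0 < length m\<close> \<rho> in \<open>simp_all add: adjacency_program_nth set_reg_def \<rho>1_def\<close>)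
  show ?thesis
  proof (cases "large w n")
    case True
    have m: "m = large_memory w n e" using True by (simp add: m_def memory_def)
    have "m ! 0 = n" by (simp add: m large_memory_header)
    then have "\<rho>1 0 = i" "\<rho>1 2 = n" "\<rho>1 9 = 0" "\<rho>1 1 = \<rho> 1"
      using \<rho> by (simp_all add: \<rho>1_def)
    then obtain \<rho>' where \<rho>': "straight w m decode_endpoint \<rho>1 = Some \<rho>'" "\<rho>' 3 = e i" "\<rho>' 1 = \<rho> 1"
      using straight_decode_endpoint[OF e True i, of \<rho>1] m by auto
    obtain c where c: "reaches w 2 \<lparr>pc = 8, regs = \<rho>', mem = m\<rparr> c" "answered m (\<rho> 1 \<le> e i) c"
      using compare_endpoint[OF w, of \<rho>' m] \<rho>' by auto
    have "reaches w (Suc 2) \<lparr>pc = 97, regs = \<rho>', mem = m\<rparr> c"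
      by (rule reaches_instr[OF c(1)]) (simp_all add: adjacency_program_nth)
    moreover have "reaches w 84 \<lparr>pc = 13, regs = \<rho>1, mem = m\<rparr> \<lparr>pc = 97, regs = \<rho>', mem = m\<rparr>"
    proof -
      define pre where "pre = [JUMP_EQ 0 1 11, JUMP_LESS 0 1 5, BINOP OR 2 0 0, BINOP OR 0 1 1,
        BINOP OR 1 2 2, LOAD 2 9, JUMP_LESS 9 2 13, LOAD 3 0,
        JUMP_LESS 3 1 11, LITERAL 0 1, HALT, LITERAL 0 0, HALT]"
      have "length pre = 13" "adjacency_program = pre @ decode_endpoint @ [JUMP 8]"
        by (simp_all add: pre_def adjacency_program_def)
      then have "(step w adjacency_program ^^ 84) \<lparr>pc = 13, regs = \<rho>1, mem = m\<rparr>
          \<lparr>pc = 97, regs = \<rho>', mem = m\<rparr>"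
        using straight_steps[OF \<rho>'(1), of pre "[JUMP 8]"] by (simp add: length_decode_endpoint)
      then show ?thesis by (auto simp: reaches_def)
    qed
    ultimately have "reaches w (84 + Suc 2) \<lparr>pc = 13, regs = \<rho>1, mem = m\<rparr> c"
      using reaches_trans by blast
    then have "reaches w (Suc (84 + Suc 2)) \<lparr>pc = 6, regs = \<rho>1, mem = m\<rparr> c"
      by (rule reaches_instr)
        (use i \<open>\<rho>1 2 = n\<close> \<open>\<rho>1 9 = 0\<close> in \<open>simp_all add: adjacency_program_nth\<close>)
    then have "reaches w (Suc (Suc (84 + Suc 2))) \<lparr>pc = 5, regs = \<rho>, mem = m\<rparr> c"
      by (rule fetch)
    then have "reaches w 90 \<lparr>pc = 5, regs = \<rho>, mem = m\<rparr> c"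
      by (rule reaches_mono) simp
    then show ?thesis using c(2) by (auto simp: m_def)
  next
    case False
    have m: "m = 0 # map e [1..<n + 1]" using False by (simp add: m_def memory_def)
    have mi: "i < length m" "m ! i = e i" "m ! 0 = 0"
      using i by (auto simp: m nth_Cons' simp del: upt_Suc)
    define \<rho>' where "\<rho>' = \<rho>1(3 := e i)"
    have \<rho>': "\<rho>' 3 = e i" "\<rho>' 1 = \<rho> 1" by (simp_all add: \<rho>'_def \<rho>1_def)
    obtain c where c: "reaches w 2 \<lparr>pc = 8, regs = \<rho>', mem = m\<rparr> c" "answered m (\<rho> 1 \<le> e i) c"
      using compare_endpoint[OF w, of \<rho>' m] \<rho>' by auto
    have "reaches w (Suc 2) \<lparr>pc = 7, regs = \<rho>1, mem = m\<rparr> c"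
      by (rule reaches_instr[OF c(1)])
        (use mi \<rho> in \<open>simp_all add: adjacency_program_nth set_reg_def \<rho>'_def \<rho>1_def\<close>)
    then have "reaches w (Suc (Suc 2)) \<lparr>pc = 6, regs = \<rho>1, mem = m\<rparr> c"
      by (rule reaches_instr)
        (use mi \<rho> in \<open>simp_all add: adjacency_program_nth \<rho>1_def\<close>)
    then have "reaches w (Suc (Suc (Suc 2))) \<lparr>pc = 5, regs = \<rho>, mem = m\<rparr> c"
      by (rule fetch)
    then have "reaches w 90 \<lparr>pc = 5, regs = \<rho>, mem = m\<rparr> c"
      by (rule reaches_mono) simp
    then show ?thesis using c(2) by (auto simp: m_def)
  qed
qed

lemma adjacency_program_correct:
  assumes rep: "universal_interval_representation n E e" and n: "n < 2 ^ w"
    and u: "u \<in> {1..n}" and v: "v \<in> {1..n}"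
  shows "answers_query w adjacency_program (memory w n e) 95 u v (E u v)"
proof -
  define m where "m = memory w n e"
  have e: "\<forall>i\<in>{1..n}. e i \<in> {i..n}"
    and E: "E u v \<longleftrightarrow> u \<noteq> v \<and> {real u..real (e u)} \<inter> {real v..real (e v)} \<noteq> {}"
    using rep u v by (auto simp: universal_interval_representation_def interval_representation_def)
  have eu: "u \<le> e u" and ev: "v \<le> e v" using e u v by auto
  \<comment> \<open>The later interval starts at \<open>v\<close>, so the two intervals meet exactly
    if the point \<open>v\<close> lies in both.\<close>
  have E_less: "E u v \<longleftrightarrow> v \<le> e u" if "u < v"
    using that ev by (auto simp: E intro!: exI[of _ "real v"])
  have E_greater: "E u v \<longleftrightarrow> u \<le> e v" if "v < u"
    using that eu by (auto simp: E intro!: exI[of _ "real u"])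
  define \<rho> where "\<rho> = ((\<lambda>_. 0) :: nat \<Rightarrow> nat)(0 := u, 1 := v)"
  have start: "query_config m u v = \<lparr>pc = 0, regs = \<rho>, mem = m\<rparr>"
    by (simp add: query_config_def \<rho>_def)
  have \<rho>: "\<rho> 0 = u" "\<rho> 1 = v" "\<rho> (Suc 0) = v" "\<rho> 9 = 0" by (simp_all add: \<rho>_def)
  have "\<exists>c. reaches w 95 (query_config m u v) c \<and> answered m (E u v) c"
  proof (cases u v rule: linorder_cases)
    case equal
    obtain c where c: "reaches w 1 \<lparr>pc = 11, regs = \<rho>, mem = m\<rparr> c" "answered m False c"
      using answer_no by blast
    have "reaches w (Suc 1) (query_config m u v) c"
      by (rule reaches_instr[OF c(1)]) (unfold start, use equal \<rho> in \<open>simp_all add: adjacency_program_nth\<close>)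
    then have "reaches w 95 (query_config m u v) c"
      by (rule reaches_mono) simp
    moreover have "\<not> E u v" unfolding E using equal by simp
    ultimately show ?thesis using c(2) by auto
  next
    case less
    obtain c where c: "reaches w 90 \<lparr>pc = 5, regs = \<rho>, mem = m\<rparr> c" "answered m (E u v) c"
      using answer_ordered[where \<rho> = \<rho>, OF e n u \<rho>(1,4)] \<rho> E_less[OF less] by (auto simp: m_def)
    have "reaches w (Suc 90) \<lparr>pc = 1, regs = \<rho>, mem = m\<rparr> c"
      by (rule reaches_instr[OF c(1)])
        (use less \<rho> adjacency_program_nth(2) in \<open>simp_all\<close>)
    then have "reaches w (Suc (Suc 90)) (query_config m u v) c"
      by (rule reaches_instr) (use less \<rho> in \<open>simp_all add: start adjacency_program_nth\<close>)
    then have "reaches w 95 (query_config m u v) c"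
      by (rule reaches_mono) simp
    then show ?thesis using c(2) by auto
  next
    case greater
    \<comment> \<open>The register contents after the swap. Its path takes five steps to reach
      position 5, whence the bound 95.\<close>
    define \<rho>' where "\<rho>' = \<rho>(2 := u, 0 := v, 1 := u)"
    have \<rho>': "\<rho>' 0 = v" "\<rho>' 1 = u" "\<rho>' 9 = 0" using \<rho> by (simp_all add: \<rho>'_def)
    obtain c where c: "reaches w 90 \<lparr>pc = 5, regs = \<rho>', mem = m\<rparr> c" "answered m (E u v) c"
      using answer_ordered[where \<rho> = \<rho>', OF e n v \<rho>'(1,3)] \<rho>' E_greater[OF greater]
      by (auto simp: m_def)
    have "reaches w (Suc 90) \<lparr>pc = 4, regs = \<rho>(2 := u, 0 := v), mem = m\<rparr> c"
      by (rule reaches_instr[OF c(1)])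
        (use \<rho> in \<open>simp_all add: adjacency_program_nth set_reg_def \<rho>'_def\<close>)
    then have "reaches w (Suc (Suc 90)) \<lparr>pc = 3, regs = \<rho>(2 := u), mem = m\<rparr> c"
      by (rule reaches_instr) (use \<rho> in \<open>simp_all add: adjacency_program_nth set_reg_def\<close>)
    then have "reaches w (Suc (Suc (Suc 90))) \<lparr>pc = 2, regs = \<rho>, mem = m\<rparr> c"
      by (rule reaches_instr) (use \<rho> in \<open>simp_all add: adjacency_program_nth set_reg_def\<close>)
    then have "reaches w (Suc (Suc (Suc (Suc 90)))) \<lparr>pc = 1, regs = \<rho>, mem = m\<rparr> c"
      by (rule reaches_instr) (use greater \<rho> adjacency_program_nth(2) in \<open>simp_all\<close>)
    then have "reaches w (Suc (Suc (Suc (Suc (Suc 90))))) (query_config m u v) c"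
      by (rule reaches_instr) (use greater \<rho> in \<open>simp_all add: start adjacency_program_nth\<close>)
    then have "reaches w 95 (query_config m u v) c"
      by (rule reaches_mono) simp
    then show ?thesis using c(2) by auto
  qed
  then show ?thesis
    unfolding answers_query_def reaches_def answered_def m_def by blast
qed

section \<open>Space\<close>

lemma fact_times_power_le: "fact a * a ^ s \<le> (fact (a + s) :: nat)"
proof (induction s)
  case 0
  then show ?case by simp
next
  case (Suc s)
  have "fact a * a ^ Suc s = a * (fact a * a ^ s)" by simp
  also have "\<dots> \<le> Suc (a + s) * fact (a + s)" by (rule mult_mono) (use Suc.IH in auto)
  finally show ?case by simp
qed

lemma fact_add_le: "fact (a + s) \<le> fact a * ((a + s) ^ s :: nat)"
proof (induction s)
  case 0
  then show ?case by simp
next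
  case (Suc s)
  have "(fact (a + Suc s) :: nat) = (a + Suc s) * fact (a + s)" by simp
  also have "\<dots> \<le> (a + Suc s) * (fact a * (a + s) ^ s)" by (intro mult_left_mono Suc.IH) simp
  also have "\<dots> \<le> (a + Suc s) * (fact a * (a + Suc s) ^ s)"
    by (intro mult_left_mono power_mono) auto
  also have "\<dots> = fact a * (a + Suc s) ^ Suc s" by (simp only: power_Suc mult_ac)
  finally show ?case .
qed

text \<open>The factors of \<open>fact (s * Suc m)\<close> split into blocks of length
  \<open>s\<close>, and those of block \<open>j\<close> are at least \<open>j * s\<close>; block 0
  is estimated by 1. This matches storing all items of a row with a common bound.\<close>

lemma fact_blocks_ge: "(s ^ m * fact m) ^ s \<le> (fact (s * Suc m) :: nat)"
proof (induction m)
  case 0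
  then show ?case by simp
next
  case (Suc m)
  have "(s ^ Suc m * fact (Suc m)) ^ s = (s ^ m * fact m) ^ s * (s * Suc m) ^ s"
    by (simp add: power_mult_distrib[symmetric] mult_ac del: mult_Suc_right mult_Suc)
  also have "\<dots> \<le> fact (s * Suc m) * (s * Suc m) ^ s"
    by (intro mult_right_mono Suc.IH) simp
  also have "\<dots> \<le> fact (s * Suc m + s)" by (rule fact_times_power_le)
  finally show ?case by (simp add: add.commute)
qed

text \<open>The induction step rests on Bernoulli's inequality in the form
  \<open>(1 + 1 / (n + 1)) ^ (n + 1) \<ge> 2\<close>. The factor 1/2 saves \<open>n\<close> bits in
  \<open>log_fact_le\<close>, which later absorb the redundancy.\<close>

lemma fact_le_half_power: "(fact n :: real) \<le> ((real n + 1) / 2) ^ n"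
proof (induction n)
  case 0
  then show ?case by simp
next
  case (Suc n)
  define x where "x = (real n + 1) / 2"
  have "0 < x" by (simp add: x_def)
  have "2 \<le> 1 + real (Suc n) * (1 / (real n + 1))" by simp
  also have "\<dots> \<le> (1 + 1 / (real n + 1)) ^ Suc n"
    by (rule Bernoulli_inequality) (simp add: field_simps)
  finally have B: "2 \<le> (1 + 1 / (real n + 1)) ^ Suc n" .
  have "fact (Suc n) = 2 * x * fact n" by (simp add: x_def)
  also have "\<dots> \<le> 2 * x * x ^ n" using Suc.IH \<open>0 < x\<close> by (simp add: x_def)
  also have "\<dots> = 2 * x ^ Suc n" by simp
  also have "\<dots> \<le> (1 + 1 / (real n + 1)) ^ Suc n * x ^ Suc n"
    using B \<open>0 < x\<close> by (intro mult_right_mono) auto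
  also have "\<dots> = ((1 + 1 / (real n + 1)) * x) ^ Suc n" by (simp only: power_mult_distrib)
  also have "(1 + 1 / (real n + 1)) * x = (real (Suc n) + 1) / 2" by (simp add: x_def field_simps)
  finally show ?case .
qed

lemma log_fact_le: "log 2 (fact n) \<le> real n * log 2 (real n + 1) - real n"
proof -
  have "log 2 (fact n) \<le> log 2 (((real n + 1) / 2) ^ n)"
    using fact_le_half_power[of n] by (intro log_mono) auto
  also have "\<dots> = real n * (log 2 (real n + 1) - 1)"
    by (simp add: log_nat_power log_divide)
  finally show ?thesis by (simp add: algebra_simps)
qed

section \<open>Cost of the spill-over chain in one column\<close>

text \<open>Up to the factor \<open>(1 + 2 / (b + 1)) * (1 + 1 / t)\<close>, a row loses no space.\<close>

lemma two_power_width_step: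
  assumes "0 < t"
  shows "2 ^ width t b * spill_bound t (Suc b) \<le> spill_bound t b * ((b + 3) * (t + 1))"
proof -
  define C where "C = radix t b"
  define q where "q = Suc b * t div C"
  have "q * C \<le> Suc b * t" by (simp add: q_def)
  moreover have "q \<le> Suc b"
    using spill_bound_le[OF assms, of "Suc b"] by (simp add: spill_bound_Suc q_def C_def)
  moreover have "C < 2 * t" unfolding C_def by (rule radix_less[OF assms])
  \<comment> \<open>The left side is \<open>(C + 1) * (q + 1)\<close> expanded; the right side is
    \<open>(b + 3) * t + b + 2\<close>.\<close>
  ultimately have "q * C + C + q + 1 \<le> Suc b * t + 2 * t + Suc b + 1" by linarith
  then have "(C + 1) * (q + 1) \<le> (b + 3) * (t + 1)" by (simp add: algebra_simps)
  then have "spill_bound t b * ((C + 1) * (q + 1)) \<le> spill_bound t b * ((b + 3) * (t + 1))"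
    by (rule mult_left_mono) simp
  moreover have "2 ^ width t b * (q + 1) \<le> spill_bound t b * (C + 1) * (q + 1)"
    using two_power_width_less_spill_bound[of t b] unfolding C_def
    by (intro mult_right_mono) auto
  moreover have "spill_bound t (Suc b) = q + 1" by (simp add: spill_bound_Suc q_def C_def)
  ultimately show ?thesis by (simp only: mult.assoc)
qed

text \<open>In the product of the inequalities of \<open>two_power_width_step\<close> the spill
  bounds cancel between consecutive rows, and the factors \<open>b + 3\<close> multiply up to at
  most \<open>fact (N + 2)\<close>.\<close>

lemma two_power_sum_width_le:
  assumes "0 < t"
  shows "2 ^ (\<Sum>b<N. width t b) * spill_bound t N \<le> fact (N + 2) * (t + 1) ^ N"
proof (induction N)
  case 0
  then show ?case by simp
next
  case (Suc N)
  have "2 ^ (\<Sum>b<Suc N. width t b) * spill_bound t (Suc N) =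
      2 ^ (\<Sum>b<N. width t b) * (2 ^ width t N * spill_bound t (Suc N))"
    by (simp add: power_add)
  also have "\<dots> \<le> 2 ^ (\<Sum>b<N. width t b) * (spill_bound t N * ((N + 3) * (t + 1)))"
    by (intro mult_left_mono two_power_width_step assms) simp
  also have "\<dots> \<le> fact (N + 2) * (t + 1) ^ N * ((N + 3) * (t + 1))"
    unfolding mult.assoc[symmetric, of "2 ^ (\<Sum>b<N. width t b)"]
    using Suc.IH by (intro mult_right_mono) auto
  also have "\<dots> = fact (Suc N + 2) * (t + 1) ^ Suc N"
    by (simp add: algebra_simps)
  finally show ?case .
qed

text \<open>The 2 in each summand pays for the low bits and turns \<open>t + 1\<close> into
  \<open>4 * t + 4\<close>. The surplus over the main term is the logarithm of a polynomial.\<close>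

lemma sum_width_le:
  assumes "0 < t" "m \<le> t"
  shows "(\<Sum>b<m + 3. real (width t b) + 2) \<le>
    log 2 (real ((4 * t) ^ m * fact m)) + log 2 (3 * (real m + 5) ^ 5 * (4 * real t + 4) ^ 3)"
proof -
  define S where "S = (\<Sum>b<m + 3. width t b)"
  have "2 ^ S * 1 \<le> 2 ^ S * spill_bound t (m + 3)"
    using spill_bound_pos[of t "m + 3"] by (intro mult_left_mono) auto
  also have "\<dots> \<le> fact (m + 5) * (t + 1) ^ (m + 3)"
    using two_power_sum_width_le[OF assms(1), of "m + 3"] by (simp add: S_def add.commute)
  also have "\<dots> \<le> fact m * (m + 5) ^ 5 * (t + 1) ^ (m + 3)"
    by (intro mult_right_mono fact_add_le) simp
  finally have "4 ^ (m + 3) * 2 ^ S \<le> 4 ^ (m + 3) * (fact m * (m + 5) ^ 5 * (t + 1) ^ (m + 3))"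
    by simp
  also have "4 ^ (m + 3) * (fact m * (m + 5) ^ 5 * (t + 1) ^ (m + 3)) =
      fact m * (m + 5) ^ 5 * (4 * t + 4) ^ (m + 3)"
  proof -
    have "(4 * t + 4) ^ (m + 3) = (4 * (t + 1)) ^ (m + 3)" by (simp add: add.commute)
    then show ?thesis by (simp only: power_mult_distrib mult_ac)
  qed
  finally have "real (4 ^ (m + 3) * 2 ^ S) \<le> real (fact m * (m + 5) ^ 5 * (4 * t + 4) ^ (m + 3))"
    by (simp only: of_nat_le_iff)
  then have 1: "4 ^ (m + 3) * 2 ^ S \<le> fact m * (real m + 5) ^ 5 * (4 * real t + 4) ^ (m + 3)"
    by (simp add: add.commute)
  \<comment> \<open>Here \<open>m \<le> t\<close> enters: the rounding losses of all full rows
    together cost at most a factor \<open>exp 1 \<le> 3\<close>.\<close>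
  have "(1 + 1 / real t) ^ m \<le> exp (1 / real t) ^ m"
    by (intro power_mono exp_ge_add_one_self) auto
  also have "\<dots> = exp (real m / real t)" by (simp flip: exp_of_nat_mult)
  also have "\<dots> \<le> exp 1" using assms by simp
  also have "\<dots> \<le> (3::real)" by (rule exp_le)
  finally have "(4 * real t) ^ m * (1 + 1 / real t) ^ m \<le> (4 * real t) ^ m * 3"
    by (intro mult_left_mono) auto
  moreover have "(4 * real t) ^ m * (1 + 1 / real t) ^ m = (4 * real t + 4) ^ m"
  proof -
    have "4 * real t * (1 + 1 / real t) = 4 * real t + 4"
      using assms(1) by (simp add: distrib_left)
    then show ?thesis by (simp only: power_mult_distrib[symmetric])
  qed
  ultimately have "(4 * real t + 4) ^ m \<le> (4 * real t) ^ m * 3" by (simp only:)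
  then have "(4 * real t + 4) ^ m * (4 * real t + 4) ^ 3 \<le> (4 * real t) ^ m * 3 * (4 * real t + 4) ^ 3"
    by (intro mult_right_mono) auto
  then have "(4 * real t + 4) ^ (m + 3) \<le> (4 * real t) ^ m * 3 * (4 * real t + 4) ^ 3"
    by (simp only: power_add)
  then have "fact m * (real m + 5) ^ 5 * (4 * real t + 4) ^ (m + 3) \<le>
      fact m * (real m + 5) ^ 5 * ((4 * real t) ^ m * 3 * (4 * real t + 4) ^ 3)"
    by (intro mult_left_mono) auto
  then have "4 ^ (m + 3) * 2 ^ S \<le>
      fact m * (real m + 5) ^ 5 * ((4 * real t) ^ m * 3 * (4 * real t + 4) ^ 3)"
    by (rule order_trans[OF 1])
  also have "\<dots> = real ((4 * t) ^ m * fact m) * (3 * (real m + 5) ^ 5 * (4 * real t + 4) ^ 3)"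
    by (simp add: mult_ac)
  finally have "4 ^ (m + 3) * 2 ^ S \<le>
      real ((4 * t) ^ m * fact m) * (3 * (real m + 5) ^ 5 * (4 * real t + 4) ^ 3)" .
  then have "log 2 (4 ^ (m + 3) * 2 ^ S) \<le>
      log 2 (real ((4 * t) ^ m * fact m) * (3 * (real m + 5) ^ 5 * (4 * real t + 4) ^ 3))"
    by (intro log_mono) auto
  also have "\<dots> = log 2 (real ((4 * t) ^ m * fact m)) + log 2 (3 * (real m + 5) ^ 5 * (4 * real t + 4) ^ 3)"
    using assms(1) by (intro log_mult_pos mult_pos_pos zero_less_power) (auto simp: add_pos_pos)
  also have "log 2 (4 ^ (m + 3) * 2 ^ S) = (\<Sum>b<m + 3. real (width t b) + 2)"
  proof -
    have "(4::real) ^ (m + 3) * 2 ^ S = 2 ^ (2 * (m + 3) + S)"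
      by (simp add: power_add power_mult)
    then show ?thesis by (simp add: log_nat_power sum.distrib S_def del: sum.lessThan_Suc)
  qed
  finally show ?thesis .
qed

section \<open>Total space\<close>

lemma quarter_bounds: "sqrt (real n) < real (quarter n)" "real (quarter n) \<le> sqrt (real n) + 1"
proof -
  have "real (nat \<lfloor>sqrt (real n)\<rfloor>) = of_int \<lfloor>sqrt (real n)\<rfloor>" by simp
  then show "sqrt (real n) < real (quarter n)" "real (quarter n) \<le> sqrt (real n) + 1"
    unfolding quarter_def by linarith+
qed

lemma div_side_le: "real (n div side n) \<le> sqrt (real n)"
proof -
  have "real (n div side n) * sqrt (real n) \<le> real (n div side n) * real (side n)"
    using quarter_bounds(1)[of n] by (intro mult_left_mono) (auto simp: side_def)
  also have "\<dots> \<le> real n"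
    unfolding of_nat_mult[symmetric] of_nat_le_iff by simp
  also have "\<dots> = sqrt (real n) * sqrt (real n)" by simp
  finally show ?thesis
    by (cases "n = 0") (simp_all del: real_sqrt_mult_self)
qed

text \<open>The first summand is the loss of the chains over all columns; the second is for the
  header, the table and the rounding to whole words. The word size \<open>k\<close> is real so that
  \<open>c * log 2 n\<close> can replace it.\<close>

definition redundancy :: "real \<Rightarrow> nat \<Rightarrow> real" where
  "redundancy k n =
     (4 * sqrt (real n) + 4) * log 2 (3 * (sqrt (real n) + 5) ^ 5 * (4 * sqrt (real n) + 8) ^ 3) +
     k * (8 * sqrt (real n) + 20)"

text \<open>Division by \<open>w\<close> rounds down, so each of the two arrays of a row costs at
  most its bits and two extra words.\<close>

lemma row_words_space:
  "w * row_length w n b \<le> side n * (width (quarter n) b + 2) + 4 * w"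
proof -
  have div: "w * (a div w) \<le> a" for a by simp
  have "w * row_length w n b =
      w * (side n * width (quarter n) b div w) + w * (side n * 2 div w) + 4 * w"
    by (simp add: row_length_def high_length_def packed_length_def algebra_simps)
  also have "\<dots> \<le> side n * width (quarter n) b + side n * 2 + 4 * w"
    by (intro add_mono div order_refl)
  finally show ?thesis by (simp add: algebra_simps)
qed

lemma large_memory_space:
  assumes "side n \<le> n"
  shows "real w * real (row_start w n (row_count n + 1)) \<le> log 2 (fact n) + redundancy (real w) n"
proof -
  define s where "s = side n"
  define t where "t = quarter n"
  have s: "s = 4 * t" and "0 < t" by (simp_all add: s_def t_def side_def quarter_pos)
  have "1 \<le> n div s" using div_le_mono[OF assms, of s] side_pos[of n] by (simp add: s_def)
  \<comment> \<open>There are \<open>m + 1\<close> full rows, and \<open>m + 3\<close> rows are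
    stored: also the partial row and the row for its spill.\<close>
  then obtain m where m: "n div s = Suc m" by (cases "n div s") auto
  have rows: "row_count n + 1 = m + 3" using m by (simp add: row_count_def s_def)
  have sm: "real (Suc m) \<le> sqrt (real n)" using div_side_le[of n] m by (simp add: s_def)
  have tb: "sqrt (real n) < real t" "real t \<le> sqrt (real n) + 1"
    using quarter_bounds[of n] by (simp_all add: t_def)
  have "m \<le> t" using sm tb by linarith
  define L where "L = log 2 (3 * (real m + 5) ^ 5 * (4 * real t + 4) ^ 3)"
  have "w * row_start w n (row_count n + 1) =
      w * (4 * (row_count n + 2)) + (\<Sum>b<m + 3. w * row_length w n b)"
    unfolding row_start_def rows by (subst distrib_left) (simp only: sum_distrib_left)
  also have "\<dots> \<le> w * (4 * (row_count n + 2)) + (\<Sum>b<m + 3. s * (width t b + 2) + 4 * w)"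
    unfolding s_def t_def by (intro add_mono order_refl sum_mono row_words_space)
  also have "\<dots> = s * (\<Sum>b<m + 3. width t b + 2) + w * (8 * m + 28)"
    using rows by (simp add: sum.distrib sum_distrib_left algebra_simps del: sum.lessThan_Suc)
  finally have "real (w * row_start w n (row_count n + 1)) \<le>
      real (s * (\<Sum>b<m + 3. width t b + 2) + w * (8 * m + 28))"
    by (simp only: of_nat_le_iff)
  then have 1: "real w * real (row_start w n (row_count n + 1)) \<le>
      real s * (\<Sum>b<m + 3. real (width t b) + 2) + real w * (8 * real m + 28)"
    by (simp add: add.commute del: sum.lessThan_Suc)
  have "real s * (\<Sum>b<m + 3. real (width t b) + 2) \<le>
      real s * (log 2 (real (s ^ m * fact m)) + L)"
    using sum_width_le[OF \<open>0 < t\<close> \<open>m \<le> t\<close>] by (intro mult_left_mono) (simp_all add: s L_def)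
  also have "\<dots> = log 2 (real ((s ^ m * fact m) ^ s)) + real s * L"
  proof -
    have "0 < real (s ^ m * fact m)" using \<open>0 < t\<close> s by simp
    then show ?thesis by (simp only: of_nat_power log_nat_power distrib_left)
  qed
  also have "log 2 (real ((s ^ m * fact m) ^ s)) \<le> log 2 (real (fact n))"
  proof (rule log_mono)
    \<comment> \<open>The full rows contain at most \<open>n\<close> items, so the block estimate
      can be compared with \<open>fact n\<close>.\<close>
    have "s * Suc m \<le> n" using m div_times_less_eq_dividend[of n s] by (simp add: mult.commute)
    then have "(fact (s * Suc m) :: nat) \<le> fact n" by (rule fact_mono)
    then show "real ((s ^ m * fact m) ^ s) \<le> real (fact n)"
      using fact_blocks_ge[of s m] by (simp only: of_nat_le_iff)
    show "0 < real ((s ^ m * fact m) ^ s)" using \<open>0 < t\<close> s by simp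
  qed simp
  finally have 2: "real s * (\<Sum>b<m + 3. real (width t b) + 2) \<le> log 2 (fact n) + real s * L"
    by simp
  have "L \<le> log 2 (3 * (sqrt (real n) + 5) ^ 5 * (4 * sqrt (real n) + 8) ^ 3)"
    unfolding L_def using sm tb
    by (intro log_mono mult_mono power_mono mult_pos_pos zero_less_power) (auto simp: add_nonneg_pos)
  moreover have "0 \<le> L"
  proof -
    have "1 * 1 ^ 5 * 1 ^ 3 \<le> 3 * (real m + 5) ^ 5 * (4 * real t + 4) ^ 3"
      by (intro mult_mono power_mono) auto
    then show ?thesis by (simp add: L_def)
  qed
  ultimately have "real s * L \<le>
      (4 * sqrt (real n) + 4) * log 2 (3 * (sqrt (real n) + 5) ^ 5 * (4 * sqrt (real n) + 8) ^ 3)"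
    using tb by (intro mult_mono) (auto simp: s)
  moreover have "real w * (8 * real m + 28) \<le> real w * (8 * sqrt (real n) + 20)"
    using sm by (intro mult_left_mono) auto
  ultimately show ?thesis using 1 2 by (simp add: redundancy_def)
qed

section \<open>Asymptotic behavior\<close>

lemma redundancy_bigo:
  assumes "0 < c"
  shows "(\<lambda>n. redundancy (c * log 2 (real n)) n) \<in> O(\<lambda>n. sqrt (real n) * log 2 (real n))"
  using assms unfolding redundancy_def by real_asymp

text \<open>The products \<open>s * w\<close> are of order \<open>sqrt n * log n\<close>. The
  redundancy is eventually at most the \<open>n\<close> bits saved by \<open>log_fact_le\<close>, so
  the memory has at most \<open>n\<close> words, since \<open>log 2 (n + 1) \<le> w\<close>.\<close>

lemma eventually_large:
  fixes w :: "nat \<Rightarrow> nat"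
  assumes w: "\<forall>\<^sub>F n in sequentially. real (w n) \<le> c * log 2 (real n)" and "0 < c"
    and n: "\<And>n. n < 2 ^ w n"
  shows "\<forall>\<^sub>F n in sequentially. large (w n) n \<and> side n \<le> n"
proof -
  have "\<forall>\<^sub>F n in sequentially. (4 * sqrt (real n) + 4) * (c * log 2 (real n)) \<le> real n"
    using \<open>0 < c\<close> by real_asymp
  moreover have "\<forall>\<^sub>F n in sequentially. redundancy (c * log 2 (real n)) n \<le> real n"
    unfolding redundancy_def using \<open>0 < c\<close> by real_asymp
  moreover have "\<forall>\<^sub>F n in sequentially. 4 * (sqrt (real n) + 1) \<le> real n / 2"
    by real_asymp
  ultimately show ?thesis
    using w eventually_ge_at_top[of "4::nat"]
  proof eventually_elim
    case (elim n)
    define s where "s = side n"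
    define t where "t = quarter n"
    have tb: "real t \<le> sqrt (real n) + 1" using quarter_bounds(2)[of n] by (simp add: t_def)
    have s: "s = 4 * t" "0 < t" by (simp_all add: s_def t_def side_def quarter_pos)
    have "4 * real t \<le> 4 * (sqrt (real n) + 1)" using tb by simp
    then have t_half: "4 * real t \<le> real n / 2" using elim(3) by (rule order_trans)
    have "s \<le> n" using t_half s by linarith
    have "real (n + 1) \<le> real (2 ^ w n)" unfolding of_nat_le_iff using n[of n] by simp
    then have "real n + 1 \<le> 2 ^ w n" by (simp add: add.commute)
    then have "log 2 (real n + 1) \<le> log 2 (2 ^ w n)" by (intro log_mono) auto
    then have logw: "log 2 (real n + 1) \<le> real (w n)" by (simp add: log_nat_power)
    have "(2::nat) ^ 2 < 2 ^ w n" using n[of n] elim(5) by simp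
    then have "3 \<le> w n" by (simp only: power_strict_increasing_iff)
    have "real s * real (w n) \<le> (4 * sqrt (real n) + 4) * (c * log 2 (real n))"
      using tb elim(4) by (intro mult_mono) (auto simp: s)
    then have "real (s * w n) \<le> real n" using elim(1) by simp
    then have "s * w n < 2 ^ w n" using n[of n] by linarith
    have "redundancy (real (w n)) n \<le> redundancy (c * log 2 (real n)) n"
      unfolding redundancy_def using elim(4) by (intro add_left_mono mult_right_mono) auto
    moreover have "log 2 (fact n) \<le> real n * log 2 (real n + 1) - real n" by (rule log_fact_le)
    ultimately have "real (w n) * real (row_start (w n) n (row_count n + 1)) \<le>
        real n * log 2 (real n + 1)"
      using large_memory_space[of n "w n"] \<open>s \<le> n\<close> elim(2) by (simp add: s_def)
    also have "\<dots> \<le> real (w n) * real n" using logw by (simp add: mult.commute mult_left_mono)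
    finally have "row_start (w n) n (row_count n + 1) \<le> n"
      using \<open>3 \<le> w n\<close> by simp
    then have "row_start (w n) n (row_count n + 1) \<le> 2 ^ w n" using n[of n] by linarith
    have "width t b < w n" if "b \<le> row_count n" for b
    proof -
      have "2 ^ width t b < 2 * (spill_bound t b * t)" by (rule two_power_width_less[OF s(2)])
      also have "\<dots> \<le> 2 * (Suc (row_count n) * t)"
        using spill_bound_le[OF s(2), of b] that by (intro mult_le_mono) auto
      also have "\<dots> \<le> n"
      proof -
        \<comment> \<open>With \<open>row_count n + 1 = n div s + 2\<close>, the full rows account
          for \<open>n / 2\<close> and the remaining \<open>4 * t\<close> for another
          \<open>n / 2\<close>.\<close>
        have "n div s * s \<le> n" by simp
        then have "real (n div s * (4 * t)) \<le> real n" by (simp only: s of_nat_le_iff)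
        then have "2 * (real (n div s) * real t) + 4 * real t \<le> real n" using t_half by simp
        then have "real (2 * (Suc (row_count n) * t)) \<le> real n"
          by (simp add: row_count_def algebra_simps flip: s_def)
        then show ?thesis by (simp only: of_nat_le_iff)
      qed
      also have "\<dots> < 2 ^ w n" by (rule n)
      finally show ?thesis by (simp only: power_strict_increasing_iff)
    qed
    then show ?case
      using n[of n] elim(5) \<open>3 \<le> w n\<close> \<open>s * w n < 2 ^ w n\<close> \<open>s \<le> n\<close>
        \<open>row_start (w n) n (row_count n + 1) \<le> 2 ^ w n\<close>
      by (simp add: large_def s_def t_def)
  qed
qed

section \<open>The data structure\<close>

theorem theorem2:
  fixes w :: "nat \<Rightarrow> nat"
  assumes "(\<lambda>n. real (w n)) \<in> \<Theta>(\<lambda>n. log 2 (real n))"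
    and "\<And>n. n < 2 ^ w n"
  shows "\<exists>P enc T. \<exists>r \<in> O(\<lambda>n. sqrt (real n) * log 2 (real n)).
    adjacency_data_structure w P enc (\<lambda>n. log 2 (fact n) + r n) T"
proof -
  obtain c where "0 < c"
    and c: "\<forall>\<^sub>F n in sequentially. norm (real (w n)) \<le> c * norm (log 2 (real n))"
    using landau_o.bigE[OF bigthetaD1[OF assms(1)]] by blast
  have w: "\<forall>\<^sub>F n in sequentially. real (w n) \<le> c * log 2 (real n)"
    using c eventually_ge_at_top[of "1::nat"] by eventually_elim simp
  define space where "space n = real (w n * memory_length (w n) n)" for n
  define f where "f n = redundancy (c * log 2 (real n)) n" for n
  \<comment> \<open>For the exceptional \<open>n\<close> the actual space is taken as
    \<open>r n\<close>. The space bound then holds for all \<open>n\<close>, and \<open>r\<close>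
    agrees with \<open>f\<close> from some point on, which preserves its growth order.\<close>
  define r where "r n = (if space n \<le> log 2 (fact n) + f n then f n else space n)" for n
  have "\<forall>\<^sub>F n in sequentially. r n = f n"
    using eventually_large[OF w \<open>0 < c\<close> assms(2)] w
  proof eventually_elim
    case (elim n)
    have "space n \<le> log 2 (fact n) + redundancy (real (w n)) n"
      using large_memory_space[of n "w n"] elim(1) by (simp add: space_def memory_length_def)
    also have "redundancy (real (w n)) n \<le> f n"
      unfolding f_def redundancy_def using elim(2) by (intro add_left_mono mult_right_mono) auto
    finally show ?case by (simp add: r_def)
  qed
  then have r: "r \<in> O(\<lambda>n. sqrt (real n) * log 2 (real n))"
    using redundancy_bigo[OF \<open>0 < c\<close>] by (subst landau_o.big.in_cong) (simp_all add: f_def)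
  \<comment> \<open>In the exceptional case this needs only
    \<open>log 2 (fact n) \<ge> 0\<close>.\<close>
  have "space n \<le> log 2 (fact n) + r n" for n
    using fact_ge_1[of n, where 'a = real] by (simp add: r_def)
  moreover have "x < 2 ^ w n"
    if "universal_interval_representation n E e" "x \<in> set (memory (w n) n e)" for n E e x
    using that unfolding universal_interval_representation_def by (blast intro: memory_words[OF assms(2)])
  ultimately have "adjacency_data_structure w adjacency_program (\<lambda>n. memory (w n) n)
      (\<lambda>n. log 2 (fact n) + r n) 95"
    unfolding adjacency_data_structure_def length_memory space_def
    using adjacency_program_correct[OF _ assms(2)] by blast
  then show ?thesis using r by blast
qed

end
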